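(* Let the disturbances $w_t$ be chosen by an adversary from a bounded set $\Omega\subseteq\mathbb{R}^n$. For $k \ge 1$, $$\mathsf{ADV}_k - \mathsf{ADV}_{k+1} = O(\|F^k\|^2) = O(\lambda^{2k}).$$
   Context: System and cost: $x_{t+1} = A x_t + B u_t + w_t$ with $x_t\in\mathbb{R}^n$, $u_t\in\mathbb{R}^d$, given $x_0$, and for horizon $T\ge1$ the cost is $J = \sum_{t=0}^{T-1} (x_t^\top Q x_t + u_t^\top R u_t) + x_T^\top Q_f x_T$. Standing assumptions: $Q,Q_f\succeq 0$, $R\succ 0$ (symmetric); $(A,B)$ is stabilizable, i.e. there is $K_0$ with $\rho(A-BK_0)<1$ ($\rho$ = spectral radius); $(A,Q)$ is detectable, i.e. $(A^\top,Q)$ is stabilizable. $P$ is the (unique positive semidefinite) solution of $P = Q + A^\top P A - A^\top P B(R + B^\top P B)^{-1} B^\top PA$; $F=A-B(R+B^\top PB)^{-1}B^\top PA$, which satisfies $\rho(F)<1$; $\lambda=\frac{1+\rho(F)}2<1$. $\|\cdot\|$ is the spectral norm. Optimal adversarial cost with $k$ (exact) predictions: $$\mathit{ADV}^T_k = \sup_{w_0, \dots, w_{k-1} \in \Omega} \Big( \min_{u_0} \Big( \sup_{w_k \in \Omega} \Big( \cdots \min_{u_{T-k-1}} \Big( \sup_{w_{T-1} \in \Omega} \Big( \min_{u_{T-k}, \dots, u_{T-1}} J \Big) \Big) \Big) \Big) \Big),\qquad \mathsf{ADV}_k=\lim_{T\to\infty}\tfrac1T\mathit{ADV}_k^T$$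 (limits understood to exist). Notation: $f(k)=O(g(k))$ means there is $C>0$ (independent of $k$) with $|f(k)|\le C\,g(k)$ for all $k\ge1$. *)

theory Defs
  imports "HOL-Analysis.Analysis"
begin

definition pos_semidef :: "real^'n^'n \<Rightarrow> bool" where
  "pos_semidef M \<longleftrightarrow> transpose M = M \<and> (\<forall>x. 0 \<le> x \<bullet> (M *v x))"

definition pos_def :: "real^'n^'n \<Rightarrow> bool" where
  "pos_def M \<longleftrightarrow> transpose M = M \<and> (\<forall>x. x \<noteq> 0 \<longrightarrow> 0 < x \<bullet> (M *v x))"

(* The eigenvalues are taken over the complex numbers; the set is finite and nonempty. *)
definition spectral_radius :: "real^'n^'n \<Rightarrow> real" where
  "spectral_radius M =
     Max {cmod \<mu> | \<mu>. \<exists>v. v \<noteq> 0 \<and> map_matrix complex_of_real M *v v = \<mu> *s v}"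

(* The operator norm induced by the Euclidean norms, not the Frobenius norm that
   the type class instance of Finite_Cartesian_Product gives to matrices. *)
definition spectral_norm :: "real^'n^'m \<Rightarrow> real" where
  "spectral_norm M = onorm ((*v) M)"

(* The power M ^ k of the type class power would be the entrywise one. *)
primrec matrix_power :: "real^'n^'n \<Rightarrow> nat \<Rightarrow> real^'n^'n" where
  "matrix_power M 0 = mat 1"
| "matrix_power M (Suc k) = M ** matrix_power M k"

definition stabilizable :: "real^'n^'n \<Rightarrow> real^'d^'n \<Rightarrow> bool" where
  "stabilizable A B \<longleftrightarrow> (\<exists>K :: real^'n^'d. spectral_radius (A - B ** K) < 1)"

definition detectable :: "real^'n^'n \<Rightarrow> real^'n^'n \<Rightarrow> bool" where
  "detectable A Q \<longleftrightarrow> stabilizable (transpose A) Q"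

definition lqr_gain :: "real^'n^'n \<Rightarrow> real^'d^'n \<Rightarrow> real^'d^'d \<Rightarrow> real^'n^'n \<Rightarrow> real^'n^'d" where
  "lqr_gain A B R P =
     matrix_inv (R + transpose B ** P ** B) ** transpose B ** P ** A"

definition dare ::
    "real^'n^'n \<Rightarrow> real^'d^'n \<Rightarrow> real^'n^'n \<Rightarrow> real^'d^'d \<Rightarrow> real^'n^'n \<Rightarrow> bool" where
  "dare A B Q R P \<longleftrightarrow>
     P = Q + transpose A ** P ** A - transpose A ** P ** B ** lqr_gain A B R P"

primrec state ::
    "real^'n^'n \<Rightarrow> real^'d^'n \<Rightarrow> real^'n \<Rightarrow> (nat \<Rightarrow> real^'d) \<Rightarrow> (nat \<Rightarrow> real^'n) \<Rightarrow> nat \<Rightarrow> real^'n" where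
  "state A B x0 u w 0 = x0"
| "state A B x0 u w (Suc t) = A *v state A B x0 u w t + B *v u t + w t"

definition lqr_cost ::
    "real^'n^'n \<Rightarrow> real^'d^'n \<Rightarrow> real^'n^'n \<Rightarrow> real^'d^'d \<Rightarrow> real^'n^'n \<Rightarrow> real^'n \<Rightarrow>
     nat \<Rightarrow> (nat \<Rightarrow> real^'d) \<Rightarrow> (nat \<Rightarrow> real^'n) \<Rightarrow> real" where
  "lqr_cost A B Q R Qf x0 T u w =
     (\<Sum>t<T. state A B x0 u w t \<bullet> (Q *v state A B x0 u w t) + u t \<bullet> (R *v u t))
     + state A B x0 u w T \<bullet> (Qf *v state A B x0 u w T)"

(* The rounds of the game in which k disturbances are known in advance and the cost of
   the controls u and disturbances w over the horizon T is J u w. With r rounds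
   left, u 0, ..., u (T-k-r-1) and w 0, ..., w (T-r-1) have been chosen, and the round
   "min over u (T-k-r), sup over w (T-r)" comes next; after the last round
   u (T-k), ..., u (T-1) are chosen together. Later entries of u and w are
   overwritten before they are used. Minima are written as infima in ereal: for a bounded
   nonempty \<Omega> and R positive definite, the costs are finite, continuous and coercive
   in the controls, so the infima are attained. *)
primrec adv_rounds ::
    "((nat \<Rightarrow> 'u) \<Rightarrow> (nat \<Rightarrow> 'w) \<Rightarrow> real) \<Rightarrow> 'w set \<Rightarrow> nat \<Rightarrow> nat \<Rightarrow>
     nat \<Rightarrow> (nat \<Rightarrow> 'u) \<Rightarrow> (nat \<Rightarrow> 'w) \<Rightarrow> ereal" where
  "adv_rounds J \<Omega> T k 0 u w = (INF v. ereal (J (override_on u v {T-k..<T}) w))"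
| "adv_rounds J \<Omega> T k (Suc r) u w =
     (INF a. SUP b\<in>\<Omega>. adv_rounds J \<Omega> T k r (u(T - k - Suc r := a)) (w(T - Suc r := b)))"

(* Only the case k \<le> T is meaningful; it suffices for the limit below.
   The initial controls are irrelevant because all of them get overwritten. *)
definition adv_cost_horizon ::
    "real^'n^'n \<Rightarrow> real^'d^'n \<Rightarrow> real^'n^'n \<Rightarrow> real^'d^'d \<Rightarrow> real^'n^'n \<Rightarrow> real^'n \<Rightarrow>
     (real^'n) set \<Rightarrow> nat \<Rightarrow> nat \<Rightarrow> ereal" where
  "adv_cost_horizon A B Q R Qf x0 \<Omega> k T =
     (SUP w \<in> {..<k} \<rightarrow>\<^sub>E \<Omega>.
        adv_rounds (lqr_cost A B Q R Qf x0 T) \<Omega> T k (T - k) (\<lambda>_. 0) w)"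

definition adv_cost_avg ::
    "real^'n^'n \<Rightarrow> real^'d^'n \<Rightarrow> real^'n^'n \<Rightarrow> real^'d^'d \<Rightarrow> real^'n^'n \<Rightarrow> real^'n \<Rightarrow>
     (real^'n) set \<Rightarrow> nat \<Rightarrow> nat \<Rightarrow> ereal" where
  "adv_cost_avg A B Q R Qf x0 \<Omega> k T =
     adv_cost_horizon A B Q R Qf x0 \<Omega> k T / ereal (real T)"

definition adv_cost ::
    "real^'n^'n \<Rightarrow> real^'d^'n \<Rightarrow> real^'n^'n \<Rightarrow> real^'d^'d \<Rightarrow> real^'n^'n \<Rightarrow> real^'n \<Rightarrow>
     (real^'n) set \<Rightarrow> nat \<Rightarrow> ereal" where
  "adv_cost A B Q R Qf x0 \<Omega> k = lim (adv_cost_avg A B Q R Qf x0 \<Omega> k)"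

end

(* Completing the square with the Riccati solution P shows that, up to the terminal cost, the cost
   of any control sequence is a term depending on the disturbances only plus a sum of squares of
   residuals u_t + K x_t + G p_t, where the costate p_t is the series of F^T ^ i P w_{t+i}. The
   controller that truncates this series after the k known disturbances has residuals of norm
   O(||F^k||), so its cost exceeds the offline optimum by O(T ||F^k||^2) + o(T). The game value with
   any number of predictions lies between the offline optimum against the worst disturbances and the
   worst-case cost of this controller, so two game values differ by no more than that. No residual
   of the optimal players has to be controlled, which is why the bound is quadratic.

   Replacing the terminal weight Qf by P costs only o(T): by detectability, a sequence of controls
   with cost O(T) has a state of squared norm O(T/m) within the last m steps, and the comparison is
   made at that time. *)

theory Submission
  imports Defs "HOL-Computational_Algebra.Fundamental_Theorem_Algebra"
begin

section \<open>Spectral radius and growth of matrix powers\<close>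

text \<open>With the terminal weight Qf the square would be completed along the time-varying Riccati
  recursion started at Qf, and its convergence to P would have to be quantified. Stopping at a time
  S at which the competing state is small avoids this: the stationary P serves as terminal weight
  for both cost sequences, and the competitor's own terminal term is absorbed into the error. The
  rate lam^k must also hold when F is defective. Instead of a Jordan form, an annihilating
  polynomial is split into linear factors, which are applied to a vector one at a time; the strict
  gap between the spectral radius and lam absorbs the polynomial growth that repeated eigenvalues
  cause.\<close>

lemma sequence_dependent:
  fixes f :: "nat \<Rightarrow> 'a::euclidean_space"
  shows "\<exists>N c. (\<exists>i\<le>N. c i \<noteq> (0::real)) \<and> (\<Sum>i\<le>N. c i *\<^sub>R f i) = 0"
proof (cases "inj_on f {..DIM('a)}")
  case True
  then have "card (f ` {..DIM('a)}) > DIM('a)" by (simp add: card_image)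
  then have "dependent (f ` {..DIM('a)})" by (intro dependent_biggerset) auto
  then obtain u v where u: "v \<in> f ` {..DIM('a)}" "u v \<noteq> 0" "(\<Sum>v\<in>f ` {..DIM('a)}. u v *\<^sub>R v) = 0"
    by (auto simp: dependent_finite)
  have "(\<Sum>i\<le>DIM('a). u (f i) *\<^sub>R f i) = 0"
    using u(3) by (simp add: sum.reindex[OF True])
  with u show ?thesis by (intro exI[of _ "DIM('a)"] exI[of _ "\<lambda>i. u (f i)"]) auto
next
  case False
  \<comment> \<open>Dependence is a notion for sets, and a repeated value collapses the image; the
    relation f i - f j = 0 covers this case.\<close>
  then obtain i j where ij: "i \<noteq> j" "f i = f j" by (auto simp: inj_on_def)
  define c where "c l = (if l = i then 1 else 0) - (if l = j then 1 else (0::real))" for l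
  have "(\<Sum>l\<le>max i j. c l *\<^sub>R f l) =
      (\<Sum>l\<le>max i j. (if l = i then f l else 0)) - (\<Sum>l\<le>max i j. (if l = j then f l else 0))"
    unfolding sum_subtractf[symmetric] by (intro sum.cong) (auto simp: c_def)
  also have "\<dots> = 0" using ij by simp
  finally show ?thesis using ij
    by (intro exI[of _ "max i j"] exI[of _ c]) (auto simp: c_def intro!: exI[of _ i])
qed

section \<open>Polynomials in a complex matrix acting on vectors\<close>

lemma norm_vector_smult: "norm (c *s (v::complex^'n)) = cmod c * norm v"
  by (simp add: norm_vec_def norm_mult L2_set_right_distrib)

text \<open>Together with \<open>poly_apply\<close> this is p(M) v. The matrix is pushed onto the
  vector and p(M) is never formed, so that a linear factor of p can be absorbed into the vector
  argument, over which the inductions generalise.\<close>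

primrec coeffs_apply :: "complex^'n^'n \<Rightarrow> complex list \<Rightarrow> complex^'n \<Rightarrow> complex^'n" where
  "coeffs_apply M [] v = 0"
| "coeffs_apply M (a # as) v = a *s v + coeffs_apply M as (M *v v)"

definition poly_apply :: "complex^'n^'n \<Rightarrow> complex poly \<Rightarrow> complex^'n \<Rightarrow> complex^'n" where
  "poly_apply M p = coeffs_apply M (coeffs p)"

lemma poly_apply_0 [simp]: "poly_apply M 0 v = 0"
  by (simp add: poly_apply_def)

lemma poly_apply_pCons [simp]: "poly_apply M (pCons a p) v = a *s v + poly_apply M p (M *v v)"
  by (cases "a = 0 \<and> p = 0") (auto simp: poly_apply_def cCons_def vec_eq_iff)

lemma poly_apply_add: "poly_apply M (p + q) v = poly_apply M p v + poly_apply M q v"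
  by (induction p q arbitrary: v rule: poly_induct2) (simp_all add: vector_sadd_rdistrib)

lemma poly_apply_smult: "poly_apply M (smult c p) v = c *s poly_apply M p v"
  by (induction p arbitrary: v) (simp_all add: vector_add_ldistrib vector_smult_assoc)

lemma poly_apply_sum: "poly_apply M (\<Sum>i\<in>I. p i) v = (\<Sum>i\<in>I. poly_apply M (p i) v)"
  by (induction I rule: infinite_finite_induct) (simp_all add: poly_apply_add)

lemma poly_apply_monom: "poly_apply M (monom c i) v = c *s ((*v) M ^^ i) v"
  by (induction i arbitrary: v) (simp_all add: monom_0 monom_Suc funpow_swap1)

lemma poly_apply_vec:
  "poly_apply M p (v + w) = poly_apply M p v + poly_apply M p w"
  "poly_apply M p (c *s v) = c *s poly_apply M p v"
  by (induction p arbitrary: v w)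
    (simp_all add: vector_add_ldistrib matrix_vector_right_distrib vector_scalar_commute mult.commute)

lemma poly_apply_linear_factor:
  "poly_apply M ([:- \<mu>, 1:] * q) v = poly_apply M q (M *v v - \<mu> *s v)"
proof -
  have "poly_apply M q (M *v v - \<mu> *s v) = poly_apply M q (M *v v + (-\<mu>) *s v)"
    by (simp add: vec_eq_iff)
  also have "\<dots> = poly_apply M q (M *v v) + (-\<mu>) *s poly_apply M q v"
    by (simp only: poly_apply_vec)
  also have "\<dots> = poly_apply M (smult (-\<mu>) q + pCons 0 q) v"
    unfolding poly_apply_add poly_apply_smult poly_apply_pCons by simp
  also have "smult (-\<mu>) q + pCons 0 q = [:- \<mu>, 1:] * q" by simp
  finally show ?thesis ..
qed

lemma poly_apply_eigenvector:
  assumes "M *v v = \<mu> *s v"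
  shows "poly_apply M p v = poly p \<mu> *s v"
  by (induction p)
    (simp_all add: assms poly_apply_vec vector_smult_assoc vector_sadd_rdistrib)

abbreviation eigenvalue :: "complex^'n^'n \<Rightarrow> complex \<Rightarrow> bool" where
  "eigenvalue M \<mu> \<equiv> \<exists>v. v \<noteq> 0 \<and> M *v v = \<mu> *s v"

lemma poly_linear_factor_induct [consumes 1, case_names const factor]:
  fixes p :: "complex poly"
  assumes "p \<noteq> 0"
    and "\<And>a. a \<noteq> 0 \<Longrightarrow> H [:a:]"
    and "\<And>\<mu> q. q \<noteq> 0 \<Longrightarrow> H q \<Longrightarrow> H ([:- \<mu>, 1:] * q)"
  shows "H p"
  using assms(1)
proof (induction "degree p" arbitrary: p)
  case 0
  then show ?case using assms(2) by (metis degree_eq_zeroE pCons_eq_0_iff)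
next
  case (Suc n)
  then have "\<not> constant (poly p)" by (simp add: constant_degree)
  then obtain \<mu> where "poly p \<mu> = 0" using fundamental_theorem_of_algebra by blast
  then obtain q where q: "p = [:- \<mu>, 1:] * q" by (auto simp: poly_eq_0_iff_dvd)
  with Suc have "q \<noteq> 0" by auto
  with q have "degree p = Suc (degree q)" by (simp add: degree_mult_eq del: mult_pCons_left)
  with Suc q \<open>q \<noteq> 0\<close> show ?case using assms(3) by auto
qed

text \<open>Splitting off a linear factor replaces v by M v - \<mu> v. The constant left at the end
  annihilates no nonzero vector, so some factor sends a nonzero vector to 0, and that vector is an
  eigenvector.\<close>

lemma annihilated_imp_eigenvalue:
  assumes "p \<noteq> 0" "v \<noteq> 0" "poly_apply M p v = 0"
  shows "\<exists>\<mu>. eigenvalue M \<mu>"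
  using assms
proof (induction p arbitrary: v rule: poly_linear_factor_induct)
  case (factor \<mu> q)
  show ?case
  proof (cases "M *v v - \<mu> *s v = 0")
    case True
    with factor show ?thesis by auto
  next
    case False
    with factor show ?thesis by (metis poly_apply_linear_factor)
  qed
qed simp

text \<open>By induction w = M v - \<mu> v decays. If |\<mu>| < lam, the recursion for the orbit of
  v driven by that of w keeps the rate lam. Otherwise \<mu> is a root of p but no eigenvalue, so M -
  \<mu> is injective, hence bounded below, and since it commutes with M the decay of w passes back
  to v.\<close>

lemma annihilated_imp_decay:
  fixes M :: "complex^'n^'n"
  assumes "p \<noteq> 0" "poly_apply M p v = 0" "lam > 0"
    and ev: "\<And>\<mu>. eigenvalue M \<mu> \<Longrightarrow> cmod \<mu> < lam"
  shows "\<exists>C. \<forall>k. norm (((*v) M ^^ k) v) \<le> C * lam ^ k"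
  using assms(1,2)
proof (induction p arbitrary: v rule: poly_linear_factor_induct)
  case (const a)
  then have "((*v) M ^^ k) v = 0" for k by (induction k) auto
  then show ?case by (intro exI[of _ 0]) simp
next
  case (factor \<mu> q)
  define w where "w = M *v v - \<mu> *s v"
  from factor obtain C where C: "\<And>k. norm (((*v) M ^^ k) w) \<le> C * lam ^ k"
    unfolding w_def by (metis poly_apply_linear_factor)
  have w_iter: "((*v) M ^^ k) w = M *v ((*v) M ^^ k) v - \<mu> *s ((*v) M ^^ k) v" for k
    by (induction k)
      (simp_all add: w_def matrix_vector_mult_diff_distrib vector_scalar_commute)
  show ?case
  proof (cases "cmod \<mu> < lam")
    case True
    \<comment> \<open>Large enough for k = 0 and for
      \<open>cmod \<mu> * D + C \<le> lam * D\<close>, which closes the induction.\<close>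
    define D where "D = max (norm v) (C / (lam - cmod \<mu>))"
    have "C \<le> D * (lam - cmod \<mu>)" using True by (simp add: D_def divide_simps max_def)
    have "norm (((*v) M ^^ k) v) \<le> D * lam ^ k" for k
    proof (induction k)
      case (Suc k)
      have "((*v) M ^^ Suc k) v = \<mu> *s ((*v) M ^^ k) v + ((*v) M ^^ k) w"
        by (simp add: w_iter)
      then have "norm (((*v) M ^^ Suc k) v) \<le> cmod \<mu> * norm (((*v) M ^^ k) v) + norm (((*v) M ^^ k) w)"
        by (metis norm_triangle_ineq norm_vector_smult)
      also have "\<dots> \<le> cmod \<mu> * (D * lam ^ k) + C * lam ^ k"
        by (intro add_mono mult_left_mono Suc C) auto
      also have "\<dots> \<le> cmod \<mu> * (D * lam ^ k) + D * (lam - cmod \<mu>) * lam ^ k"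
        using \<open>C \<le> _\<close> \<open>lam > 0\<close> by simp
      also have "\<dots> = D * lam ^ Suc k" by (simp add: algebra_simps)
      finally show ?case .
    qed (simp add: D_def)
    then show ?thesis by blast
  next
    case False
    then have "\<not> eigenvalue M \<mu>" using ev by blast
    define f where "f y = M *v y - \<mu> *s y" for y
    have scaleR: "r *\<^sub>R y = complex_of_real r *s y" for r and y :: "complex^'n"
      unfolding vec_eq_iff vector_scaleR_component vector_smult_component by (simp add: scaleR_conv_of_real)
    have lin: "linear f"
    proof (rule linearI)
      show "f (x + y) = f x + f y" for x y
        by (simp add: f_def matrix_vector_right_distrib vector_add_ldistrib)
      show "f (r *\<^sub>R y) = r *\<^sub>R f y" for r y
        unfolding f_def scaleR vector_scalar_commute by (simp add: vec_eq_iff algebra_simps)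
    qed
    moreover have "inj f"
      using \<open>\<not> eigenvalue M \<mu>\<close> unfolding linear_injective_0[OF lin] f_def by auto
    ultimately obtain B where B: "B > 0" "\<And>x. B * norm x \<le> norm (f x)"
      by (metis linear_inj_bounded_below_pos)
    have "norm (((*v) M ^^ k) v) \<le> C / B * lam ^ k" for k
    proof -
      have "B * norm (((*v) M ^^ k) v) \<le> C * lam ^ k"
        using B(2)[of "((*v) M ^^ k) v"] C[of k] by (simp add: f_def w_iter)
      then show ?thesis using B(1) by (simp add: field_simps)
    qed
    then show ?thesis by blast
  qed
qed

section \<open>Real matrices, their complex eigenvalues and the growth of their powers\<close>

definition Re_vec :: "complex^'n \<Rightarrow> real^'n" where "Re_vec v = (\<chi> i. Re (v $ i))"
definition Im_vec :: "complex^'n \<Rightarrow> real^'n" where "Im_vec v = (\<chi> i. Im (v $ i))"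

lemma Re_Im_vec_funpow:
  fixes F :: "real^'n^'n"
  shows "Re_vec (((*v) (map_matrix complex_of_real F) ^^ k) v) = matrix_power F k *v Re_vec v"
    and "Im_vec (((*v) (map_matrix complex_of_real F) ^^ k) v) = matrix_power F k *v Im_vec v"
proof -
  have *: "Re_vec (map_matrix complex_of_real F *v v) = F *v Re_vec v"
    "Im_vec (map_matrix complex_of_real F *v v) = F *v Im_vec v" for v
    by (simp_all add: Re_vec_def Im_vec_def vec_eq_iff matrix_vector_mult_def)
  show "Re_vec (((*v) (map_matrix complex_of_real F) ^^ k) v) = matrix_power F k *v Re_vec v"
    "Im_vec (((*v) (map_matrix complex_of_real F) ^^ k) v) = matrix_power F k *v Im_vec v"
    by (induction k) (simp_all add: * matrix_vector_mul_assoc)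
qed

lemma Re_Im_vec_eq_0: "v = 0 \<longleftrightarrow> Re_vec v = 0 \<and> Im_vec v = 0"
  by (auto simp: Re_vec_def Im_vec_def vec_eq_iff complex_eq_iff)

lemma norm_Re_vec_le: "norm (Re_vec v) \<le> norm v"
  by (simp add: Re_vec_def norm_vec_def L2_set_mono abs_Re_le_cmod)

text \<open>The powers of \<open>F\<close> lie in a finite-dimensional real space, so a nontrivial
  real combination of them vanishes. As its coefficients are real, its action on a complex vector
  can be checked on real and imaginary parts.\<close>

lemma real_matrix_annihilator:
  fixes F :: "real^'n^'n"
  shows "\<exists>p. p \<noteq> 0 \<and> (\<forall>v. poly_apply (map_matrix complex_of_real F) p v = 0)"
proof -
  obtain N c i where c: "i \<le> N" "c i \<noteq> (0::real)" "(\<Sum>i\<le>N. c i *\<^sub>R matrix_power F i) = 0"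
    using sequence_dependent[of "matrix_power F"] by blast
  define p where "p = (\<Sum>i\<le>N. monom (complex_of_real (c i)) i)"
  have "coeff p i \<noteq> 0" using c by (simp add: p_def coeff_sum)
  moreover have "poly_apply (map_matrix complex_of_real F) p v = 0" for v
  proof -
    let ?T = "(*v) (map_matrix complex_of_real F)"
    have eq: "poly_apply (map_matrix complex_of_real F) p v
        = (\<Sum>i\<le>N. complex_of_real (c i) *s (?T ^^ i) v)"
      by (simp add: p_def poly_apply_sum poly_apply_monom)
    have sum0: "(\<Sum>i\<le>N. c i *\<^sub>R (matrix_power F i *v x)) = 0" for x
    proof -
      have "(\<Sum>i\<le>N. c i *\<^sub>R (matrix_power F i *v x)) = (\<Sum>i\<le>N. c i *\<^sub>R matrix_power F i) *v x"
        by (induction N) (simp_all add: matrix_vector_mult_add_rdistrib scaleR_matrix_vector_assoc [symmetric])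
      then show ?thesis using c by simp
    qed
    have "Re_vec (\<Sum>i\<le>N. complex_of_real (c i) *s (?T ^^ i) v)
        = (\<Sum>i\<le>N. c i *\<^sub>R Re_vec ((?T ^^ i) v))"
      "Im_vec (\<Sum>i\<le>N. complex_of_real (c i) *s (?T ^^ i) v)
        = (\<Sum>i\<le>N. c i *\<^sub>R Im_vec ((?T ^^ i) v))"
      by (simp_all add: Re_vec_def Im_vec_def vec_eq_iff)
    then show ?thesis
      unfolding eq Re_Im_vec_eq_0 by (simp add: Re_Im_vec_funpow sum0)
  qed
  ultimately show ?thesis by (metis coeff_0)
qed

text \<open>\<open>Max\<close> is meaningful because the eigenvalues are roots of the annihilating
  polynomial, hence finitely many, and because annihilating any nonzero vector produces at least one
  of them.\<close>

lemma spectral_radius_props: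
  fixes F :: "real^'n^'n"
  shows spectral_radius_attained:
      "\<exists>\<mu>. eigenvalue (map_matrix complex_of_real F) \<mu> \<and> spectral_radius F = cmod \<mu>"
    and spectral_radius_ge:
      "eigenvalue (map_matrix complex_of_real F) \<mu> \<Longrightarrow> cmod \<mu> \<le> spectral_radius F"
proof -
  let ?M = "map_matrix complex_of_real F"
  let ?S = "{cmod \<mu> | \<mu>. eigenvalue ?M \<mu>}"
  obtain p where p: "p \<noteq> 0" "\<And>v. poly_apply ?M p v = 0"
    using real_matrix_annihilator by blast
  have "poly p \<mu> = 0" if "eigenvalue ?M \<mu>" for \<mu>
  proof -
    from that obtain v where "v \<noteq> 0" "?M *v v = \<mu> *s v" by blast
    with p(2)[of v] show ?thesis by (metis poly_apply_eigenvector vector_mul_eq_0)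
  qed
  then have "?S \<subseteq> cmod ` {\<mu>. poly p \<mu> = 0}" by blast
  then have fin: "finite ?S"
    using poly_roots_finite[OF p(1)] finite_surj by blast
  have "axis undefined 1 \<noteq> (0 :: complex^'n)" by (simp add: axis_eq_0_iff)
  from annihilated_imp_eigenvalue[OF p(1) this p(2)] have "?S \<noteq> {}" by blast
  from Max_in[OF fin this] show "\<exists>\<mu>. eigenvalue ?M \<mu> \<and> spectral_radius F = cmod \<mu>"
    by (auto simp: spectral_radius_def)
  show "cmod \<mu> \<le> spectral_radius F" if "eigenvalue ?M \<mu>"
    unfolding spectral_radius_def using that by (intro Max_ge[OF fin]) auto
qed

lemma spectral_norm_power_decay:
  fixes F :: "real^'n^'n"
  assumes "spectral_radius F < lam"
  shows "\<exists>C\<ge>0. \<forall>k. spectral_norm (matrix_power F k) \<le> C * lam ^ k"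
proof -
  let ?M = "map_matrix complex_of_real F"
  have ev: "cmod \<mu> < lam" if "eigenvalue ?M \<mu>" for \<mu>
    using spectral_radius_ge[OF that] assms by simp
  have "lam > 0"
    using spectral_radius_attained[of F] assms by (metis norm_ge_zero order_le_less_trans)
  have "\<exists>C. \<forall>k. norm (matrix_power F k *v b) \<le> C * lam ^ k" for b
  proof -
    define v where "v = (\<chi> i. complex_of_real (b $ i))"
    have b: "Re_vec v = b" by (simp add: v_def Re_vec_def vec_eq_iff)
    obtain p where "p \<noteq> 0" "poly_apply ?M p v = 0"
      using real_matrix_annihilator by blast
    then obtain C where "\<And>k. norm (((*v) ?M ^^ k) v) \<le> C * lam ^ k"
      using annihilated_imp_decay \<open>lam > 0\<close> ev by blast
    then have "norm (matrix_power F k *v b) \<le> C * lam ^ k" for k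
      using norm_Re_vec_le order_trans unfolding b[symmetric] Re_Im_vec_funpow(1)[symmetric] by blast
    then show ?thesis by blast
  qed
  then obtain c where c: "\<And>b k. norm (matrix_power F k *v b) \<le> c b * lam ^ k" by metis
  let ?C = "\<Sum>b\<in>Basis. c b"
  have le: "spectral_norm (matrix_power F k) \<le> ?C * lam ^ k" for k
    unfolding spectral_norm_def
  proof (rule onorm_le)
    fix x :: "real^'n"
    have "matrix_power F k *v x = matrix_power F k *v (\<Sum>b\<in>Basis. (x \<bullet> b) *\<^sub>R b)"
      by (simp only: euclidean_representation)
    also have "\<dots> = (\<Sum>b\<in>Basis. (x \<bullet> b) *\<^sub>R (matrix_power F k *v b))"
      by (simp add: linear_sum matrix_vector_mult_scaleR)
    also have "norm \<dots> \<le> (\<Sum>b\<in>Basis. norm x * (c b * lam ^ k))"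
      by (intro sum_norm_le)
        (auto intro!: mult_mono c simp: Basis_le_norm)
    finally show "norm (matrix_power F k *v x) \<le> ?C * lam ^ k * norm x"
      by (simp add: sum_distrib_left sum_distrib_right mult_ac)
  qed
  have "spectral_norm (matrix_power F 0) \<ge> 0"
    unfolding spectral_norm_def by (rule onorm_pos_le) simp
  then have "?C \<ge> 0" using le[of 0] by simp
  with le show ?thesis by blast
qed

text \<open>On an eigenvector for an eigenvalue \<mu> of maximal modulus the k-th power acts with
  norm |\<mu>|^k, while the real and imaginary parts of its orbit are orbits of F and tend to
  0.\<close>

lemma spectral_radius_lt_1:
  fixes F :: "real^'n^'n"
  assumes "\<And>v. (\<lambda>k. matrix_power F k *v v) \<longlonglongrightarrow> 0"
  shows "spectral_radius F < 1"
proof -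
  let ?M = "map_matrix complex_of_real F"
  obtain \<mu> v where v: "v \<noteq> 0" "?M *v v = \<mu> *s v" and rho: "spectral_radius F = cmod \<mu>"
    using spectral_radius_attained by blast
  have pow: "((*v) ?M ^^ k) v = \<mu> ^ k *s v" for k
    by (induction k) (simp_all add: v vector_scalar_commute vector_smult_assoc mult.commute)
  have "norm v \<le> norm (Re_vec v) + norm (Im_vec v)" for v :: "complex^'n"
  proof -
    have "norm v \<le> L2_set (\<lambda>i. \<bar>Re (v $ i)\<bar> + \<bar>Im (v $ i)\<bar>) UNIV"
      unfolding norm_vec_def by (intro L2_set_mono) (auto simp: cmod_le)
    also have "\<dots> \<le> norm (Re_vec v) + norm (Im_vec v)"
      by (simp add: Re_vec_def Im_vec_def norm_vec_def L2_set_triangle_ineq)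
    finally show ?thesis .
  qed
  then have "cmod \<mu> ^ k * norm v \<le> norm (matrix_power F k *v Re_vec v) + norm (matrix_power F k *v Im_vec v)" for k
    unfolding Re_Im_vec_funpow[symmetric] pow by (metis norm_power norm_vector_smult)
  note le = this
  have "(\<lambda>k. norm (matrix_power F k *v Re_vec v) + norm (matrix_power F k *v Im_vec v)) \<longlonglongrightarrow> 0"
    using tendsto_add[OF tendsto_norm_zero tendsto_norm_zero, OF assms assms] by simp
  then have "eventually (\<lambda>k. norm (matrix_power F k *v Re_vec v) + norm (matrix_power F k *v Im_vec v) < norm v)
      sequentially"
    by (rule order_tendstoD(2)) (simp add: v(1))
  then obtain k where
    "norm (matrix_power F k *v Re_vec v) + norm (matrix_power F k *v Im_vec v) < norm v"
    by (meson eventually_sequentially order_refl)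
  with le[of k] have "cmod \<mu> ^ k * norm v < 1 * norm v" by simp
  then have "cmod \<mu> ^ k < 1" using v(1) by (simp only: mult_less_cancel_right_pos zero_less_norm_iff not_False_eq_True)
  then show ?thesis using rho one_le_power[of "cmod \<mu>" k] by linarith
qed

section \<open>Stable recursions and detectability\<close>

lemma spectral_norm_ge_0: "spectral_norm M \<ge> 0" for M :: "real^'n^'m"
  unfolding spectral_norm_def by (rule onorm_pos_le) simp

lemma matrix_vector_mult_minus: "M *v (- x) = - (M *v x)" for M :: "real^'n^'m"
  by (simp add: linear_neg)

lemma norm_matrix_vector_le: "norm (M *v x) \<le> spectral_norm M * norm x" for M :: "real^'n^'m"
  unfolding spectral_norm_def by (rule onorm) simp

lemma quadratic_form_le: "x \<bullet> (M *v x) \<le> spectral_norm M * (norm x)\<^sup>2" for M :: "real^'n^'n"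
proof -
  have "x \<bullet> (M *v x) \<le> norm x * (spectral_norm M * norm x)"
    by (intro order_trans[OF norm_cauchy_schwarz] mult_left_mono norm_matrix_vector_le) auto
  then show ?thesis by (simp add: power2_eq_square mult_ac)
qed

lemma inner_transpose: "x \<bullet> (transpose M *v y) = (M *v x) \<bullet> y" for M :: "real^'n^'m"
  by (metis dot_lmul_matrix inner_commute transpose_matrix_vector)

lemma inner_symmetric_matrix:
  fixes M :: "real^'n^'n"
  assumes "transpose M = M"
  shows "x \<bullet> (M *v y) = y \<bullet> (M *v x)"
  by (metis assms inner_transpose inner_commute)

lemma spectral_norm_transpose_le: "spectral_norm (transpose M) \<le> spectral_norm M"
  for M :: "real^'n^'m"
  unfolding spectral_norm_def[of "transpose M"]
proof (rule onorm_le)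
  fix x
  let ?y = "transpose M *v x"
  have "norm ?y * norm ?y = (M *v ?y) \<bullet> x"
    by (simp only: inner_transpose[of ?y M x, symmetric] power2_norm_eq_inner power2_eq_square[symmetric])
  also have "\<dots> \<le> norm ?y * (spectral_norm M * norm x)"
    using norm_cauchy_schwarz[of "M *v ?y" x] mult_right_mono[OF norm_matrix_vector_le[of M ?y] norm_ge_zero[of x]]
    by (simp only: mult_ac)
  finally show "norm ?y \<le> spectral_norm M * norm x"
    using mult_left_le_imp_le[of "norm ?y" "norm ?y" "spectral_norm M * norm x"]
    by (cases "norm ?y = 0") (auto simp: spectral_norm_ge_0 simp del: transpose_matrix_vector)
qed

lemma spectral_norm_mult_le: "spectral_norm (X ** Y) \<le> spectral_norm X * spectral_norm Y"
  for X :: "real^'n^'m" and Y :: "real^'l^'n"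
  unfolding spectral_norm_def[of "X ** Y"]
proof (rule onorm_le)
  fix x
  have "norm (X *v (Y *v x)) \<le> spectral_norm X * (spectral_norm Y * norm x)"
    by (intro order_trans[OF norm_matrix_vector_le] mult_left_mono norm_matrix_vector_le spectral_norm_ge_0)
  then show "norm ((X ** Y) *v x) \<le> spectral_norm X * spectral_norm Y * norm x"
    by (simp add: matrix_vector_mul_assoc mult.assoc)
qed

lemma matrix_power_Suc_right: "matrix_power M (Suc k) = matrix_power M k ** M"
  by (induction k) (simp_all, metis matrix_mul_assoc)

lemma transpose_matrix_power: "transpose (matrix_power M k) = matrix_power (transpose M) k"
proof (induction k)
  case (Suc k)
  have "transpose (matrix_power M (Suc k)) = transpose (matrix_power M k ** M)"
    by (simp only: matrix_power_Suc_right)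
  then show ?case by (simp add: matrix_transpose_mul Suc)
qed simp

text \<open>Geometric decay of the norms is preferred to a condition on the spectral radius: it
  passes to the transpose by norm estimates alone and is the form in which stability enters the
  recursions.\<close>

definition power_stable :: "real^'n^'n \<Rightarrow> bool" where
  "power_stable G \<longleftrightarrow> (\<exists>c lam. 0 \<le> c \<and> 0 \<le> lam \<and> lam < 1 \<and>
     (\<forall>k. spectral_norm (matrix_power G k) \<le> c * lam ^ k))"

lemma power_stableI:
  assumes "spectral_radius G < 1"
  shows "power_stable G"
proof -
  obtain lam where lam: "spectral_radius G < lam" "lam < 1" using assms dense by blast
  have "0 \<le> lam" using spectral_radius_attained[of G] lam(1) by (metis norm_ge_zero order_le_less_trans less_imp_le)
  then show ?thesis
    using lam(2) spectral_norm_power_decay[OF lam(1)] unfolding power_stable_def by blast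
qed

lemma power_stable_transpose: "power_stable G \<Longrightarrow> power_stable (transpose G)"
  unfolding power_stable_def
  by (metis spectral_norm_transpose_le order_trans transpose_matrix_power)

text \<open>Input-to-state stability in two forms: the sup form bounds costates and the controlled
  state, the square-summed form becomes the energy estimate for detectable systems. The constant
  depends on G only, not on the horizon or the input.\<close>

lemma power_stable_recursion:
  assumes "power_stable G"
  obtains C where "C \<ge> 0"
    and "\<And>y z T Z t. \<lbrakk>\<And>t. t < T \<Longrightarrow> y (Suc t) = G *v y t + z t; \<And>t. t < T \<Longrightarrow> norm (z t) \<le> Z; Z \<ge> 0; t \<le> T\<rbrakk>
      \<Longrightarrow> norm (y t) \<le> C * (norm (y 0) + Z)"
    and "\<And>y z T. (\<And>t. t < T \<Longrightarrow> y (Suc t) = G *v y t + z t)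
      \<Longrightarrow> (\<Sum>t<T. (norm (y t))\<^sup>2) \<le> C * ((norm (y 0))\<^sup>2 + (\<Sum>t<T. (norm (z t))\<^sup>2))"
proof -
  obtain c lam where c: "0 \<le> c" and lam: "0 \<le> lam" "lam < 1"
    and decay: "\<And>k. spectral_norm (matrix_power G k) \<le> c * lam ^ k"
    using assms unfolding power_stable_def by blast
  \<comment> \<open>A scalar majorant that contracts by lam at every step, although G itself need
    not be a contraction since c may exceed 1.\<close>
  define b where "b y z = rec_nat (c * norm (y 0)) (\<lambda>t a. lam * a + c * norm (z t))"
    for y z :: "nat \<Rightarrow> real^'a"
  have b_0: "b y z 0 = c * norm (y 0)" and b_Suc: "b y z (Suc t) = lam * b y z t + c * norm (z t)" for y z t
    by (simp_all add: b_def)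
  have b_nonneg: "b y z t \<ge> 0" for y z t
    by (induction t) (simp_all add: b_0 b_Suc c lam)
  have pow: "norm (matrix_power G j *v x) \<le> lam ^ j * (c * norm x)" for j x
    using order_trans[OF norm_matrix_vector_le mult_right_mono[OF decay norm_ge_zero], of j x]
    by (simp add: mult_ac)
  \<comment> \<open>Generalising to all powers G^j lets the factor c be paid once per input instead
    of once per step.\<close>
  have "norm (matrix_power G j *v y t) \<le> lam ^ j * b y z t"
    if "\<And>t. t < T \<Longrightarrow> y (Suc t) = G *v y t + z t" "t \<le> T" for y z T t j
    using that(2)
  proof (induction t arbitrary: j)
    case 0
    then show ?case by (simp add: b_0 pow)
  next
    case (Suc t)
    then have "matrix_power G j *v y (Suc t) = matrix_power G (Suc j) *v y t + matrix_power G j *v z t"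
      by (simp add: that(1) matrix_vector_right_distrib matrix_power_Suc_right matrix_vector_mul_assoc
        del: matrix_power.simps)
    then have "norm (matrix_power G j *v y (Suc t)) \<le> lam ^ Suc j * b y z t + lam ^ j * (c * norm (z t))"
      using norm_triangle_mono[OF Suc.IH[of "Suc j"] pow[of j "z t"]] Suc.prems
      by (simp del: matrix_power.simps power_Suc)
    then show ?case by (simp add: b_Suc algebra_simps)
  qed
  from this[where j=0] have le_b: "norm (y t) \<le> b y z t"
    if "\<And>t. t < T \<Longrightarrow> y (Suc t) = G *v y t + z t" "t \<le> T" for y z T t
    using that by simp blast
  have bnd: "b y z t \<le> c / (1 - lam) * (norm (y 0) + Z)"
    if "\<And>t. t < T \<Longrightarrow> norm (z t) \<le> Z" "Z \<ge> 0" "t \<le> T" for y z T Z t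
    using that(3)
  proof (induction t)
    case 0
    have "c * norm (y 0) \<le> c * (norm (y 0) + Z) / (1 - lam)"
    proof -
      have "c * norm (y 0) * (1 - lam) \<le> c * (norm (y 0) + Z) * 1"
        using lam c \<open>Z \<ge> 0\<close> by (intro mult_mono) (auto simp: mult_left_mono)
      then show ?thesis using lam by (simp add: pos_le_divide_eq)
    qed
    then show ?case by (simp add: b_0)
  next
    case (Suc t)
    have "b y z (Suc t) \<le> lam * (c / (1 - lam) * (norm (y 0) + Z)) + c * Z"
      unfolding b_Suc using Suc that lam c by (intro add_mono mult_left_mono) auto
    also have "\<dots> \<le> lam * (c / (1 - lam) * (norm (y 0) + Z)) + c * (norm (y 0) + Z)"
      using c by (intro add_left_mono mult_left_mono) auto
    also have "\<dots> = c / (1 - lam) * (norm (y 0) + Z)"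
      using lam by (simp add: field_simps)
    finally show ?case .
  qed
  have sq: "(1 - lam) * (\<Sum>t<T. (b y z t)\<^sup>2) + (b y z T)\<^sup>2
      \<le> (c * norm (y 0))\<^sup>2 + c\<^sup>2 / (1 - lam) * (\<Sum>t<T. (norm (z t))\<^sup>2)" for y z T
  proof (induction T)
    case (Suc T)
    \<comment> \<open>With this \<eta> the next majorant is the convex combination lam \<beta> + (1
      - lam) \<eta>; the nonnegative term lam (1 - lam) (\<beta> - \<eta>)^2 is the gap in the
      convexity inequality for the square.\<close>
    define \<beta> \<zeta> \<eta> where "\<beta> = b y z T" and "\<zeta> = c * norm (z T)" and "\<eta> = \<zeta> / (1 - lam)"
    have \<zeta>: "\<zeta> = (1 - lam) * \<eta>" using lam by (simp add: \<eta>_def)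
    have "0 \<le> lam * (1 - lam) * (\<beta> - \<eta>)\<^sup>2"
      using lam by simp
    also have "\<dots> = lam * \<beta>\<^sup>2 + \<zeta> * \<eta> - (lam * \<beta> + \<zeta>)\<^sup>2"
      by (simp add: \<zeta> power2_eq_square algebra_simps)
    also have "\<zeta> * \<eta> = \<zeta>\<^sup>2 / (1 - lam)" by (simp add: \<eta>_def power2_eq_square)
    finally have "(b y z (Suc T))\<^sup>2 \<le> lam * \<beta>\<^sup>2 + c\<^sup>2 / (1 - lam) * (norm (z T))\<^sup>2"
      by (simp add: b_Suc \<beta>_def \<zeta>_def power_mult_distrib)
    with Suc show ?case by (simp add: algebra_simps \<beta>_def)
  qed (simp add: b_0)
  define C where "C = c / (1 - lam) + c\<^sup>2 / (1 - lam) + c\<^sup>2 / (1 - lam)\<^sup>2"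
  show ?thesis
  proof (rule that)
    show "C \<ge> 0" using c lam by (simp add: C_def)
    have c1: "c / (1 - lam) \<le> C" using c lam by (simp add: C_def)
    show "norm (y t) \<le> C * (norm (y 0) + Z)"
      if "\<And>t. t < T \<Longrightarrow> y (Suc t) = G *v y t + z t" "\<And>t. t < T \<Longrightarrow> norm (z t) \<le> Z" "Z \<ge> 0" "t \<le> T"
      for y z T Z t
      using le_b[where T=T and y=y and z=z, OF that(1,4)] bnd[where y=y and z=z and T=T, OF that(2-4)] mult_right_mono[OF c1, of "norm (y 0) + Z"] \<open>Z \<ge> 0\<close>
      by force
    show "(\<Sum>t<T. (norm (y t))\<^sup>2) \<le> C * ((norm (y 0))\<^sup>2 + (\<Sum>t<T. (norm (z t))\<^sup>2))"
      if "\<And>t. t < T \<Longrightarrow> y (Suc t) = G *v y t + z t" for y z T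
    proof -
      let ?Y = "(norm (y 0))\<^sup>2" and ?Z = "\<Sum>t<T. (norm (z t))\<^sup>2"
      have "(\<Sum>t<T. (norm (y t))\<^sup>2) \<le> (\<Sum>t<T. (b y z t)\<^sup>2)"
        by (intro sum_mono power_mono le_b[where T=T and z=z, OF that]) auto
      also have "(1 - lam) * \<dots> \<le> c\<^sup>2 * ?Y + c\<^sup>2 / (1 - lam) * ?Z"
        by (rule order_trans[OF _ sq[of y z T, unfolded power_mult_distrib]]) simp
      then have "(\<Sum>t<T. (b y z t)\<^sup>2) \<le> (c\<^sup>2 * ?Y + c\<^sup>2 / (1 - lam) * ?Z) / (1 - lam)"
        using lam by (simp add: pos_le_divide_eq mult.commute)
      also have "\<dots> = c\<^sup>2 / (1 - lam) * ?Y + c\<^sup>2 / (1 - lam)\<^sup>2 * ?Z"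
        by (simp add: add_divide_distrib power2_eq_square)
      also have "\<dots> \<le> C * ?Y + C * ?Z"
        using c lam by (intro add_mono mult_right_mono sum_nonneg) (auto simp: C_def)
      finally show ?thesis by (simp add: distrib_left)
    qed
  qed
qed

section \<open>Definite forms and the energy estimate from detectability\<close>

lemma pos_semidef_norm_le:
  assumes "pos_semidef Q"
  shows "(norm (Q *v x))\<^sup>2 \<le> (spectral_norm Q + 1) * (x \<bullet> (Q *v x))"
proof -
  define y where "y = Q *v x"
  \<comment> \<open>The claim is the nonnegativity of the form at x - (1/a) Q x; the summand 1 keeps
    a positive when Q = 0.\<close>
  define a where "a = spectral_norm Q + 1"
  have "a > 0" using spectral_norm_ge_0[of Q] by (simp add: a_def)
  have sym: "transpose Q = Q" and psd: "0 \<le> v \<bullet> (Q *v v)" for v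
    using assms by (auto simp: pos_semidef_def)
  have "0 \<le> (x - (1 / a) *\<^sub>R y) \<bullet> (Q *v (x - (1 / a) *\<^sub>R y))" by (rule psd)
  also have "\<dots> = x \<bullet> y - 2 * (1 / a) * (y \<bullet> y) + (1 / a)\<^sup>2 * (y \<bullet> (Q *v y))"
    using inner_symmetric_matrix[OF sym, of x y]
    by (simp add: matrix_vector_mult_diff_distrib matrix_vector_mult_scaleR inner_diff_left
        inner_diff_right y_def[symmetric] power2_eq_square algebra_simps)
  also have "\<dots> \<le> x \<bullet> y - 2 * (1 / a) * (y \<bullet> y) + (1 / a)\<^sup>2 * (a * (norm y)\<^sup>2)"
    using quadratic_form_le[of y Q] by (intro add_left_mono mult_left_mono) (simp_all add: a_def distrib_right add_increasing2)
  also have "\<dots> = x \<bullet> y - (norm y)\<^sup>2 / a"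
    using \<open>a > 0\<close> by (simp add: power2_eq_square power2_norm_eq_inner[symmetric])
  finally show ?thesis using \<open>a > 0\<close> by (simp add: field_simps y_def a_def)
qed

lemma pos_def_imp_pos_semidef: "pos_def M \<Longrightarrow> pos_semidef M"
  unfolding pos_def_def pos_semidef_def by (metis inner_zero_left less_imp_le order_refl)

lemma pos_def_inj:
  assumes "pos_def M"
  shows "inj ((*v) M)"
proof -
  have "M *v x \<noteq> 0" if "x \<noteq> 0" for x using assms that unfolding pos_def_def by force
  then show ?thesis by (subst linear_injective_0) auto
qed

lemma pos_def_bounded_below:
  fixes R :: "real^'n^'n"
  assumes "pos_def R"
  shows "\<exists>C\<ge>0. \<forall>u. (norm u)\<^sup>2 \<le> C * (u \<bullet> (R *v u))"
proof -
  obtain c where c: "c > 0" "\<And>u. c * norm u \<le> norm (R *v u)"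
    using linear_inj_bounded_below_pos[OF _ pos_def_inj[OF assms]] matrix_vector_mul_linear by metis
  have "(norm u)\<^sup>2 \<le> (spectral_norm R + 1) / c\<^sup>2 * (u \<bullet> (R *v u))" for u
  proof -
    have "(c * norm u)\<^sup>2 \<le> (norm (R *v u))\<^sup>2" using c by (intro power_mono) auto
    also note pos_semidef_norm_le[OF pos_def_imp_pos_semidef[OF assms]]
    finally show ?thesis using c(1) by (simp add: field_simps power_mult_distrib)
  qed
  moreover have "(spectral_norm R + 1) / c\<^sup>2 \<ge> 0" using spectral_norm_ge_0[of R] by simp
  ultimately show ?thesis by blast
qed

lemma norm_add3_power2_le:
  "(norm (a + b + c))\<^sup>2 \<le> 3 * ((norm a)\<^sup>2 + (norm b)\<^sup>2 + (norm c)\<^sup>2)"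
proof -
  have "(norm (a + b + c))\<^sup>2 \<le> (norm a + norm b + norm c)\<^sup>2"
    by (intro power_mono) (meson norm_triangle_ineq norm_triangle_le add_right_mono order_trans, simp)
  also have "\<dots> = 3 * ((norm a)\<^sup>2 + (norm b)\<^sup>2 + (norm c)\<^sup>2)
      - ((norm a - norm b)\<^sup>2 + (norm a - norm c)\<^sup>2 + (norm b - norm c)\<^sup>2)"
    by (simp add: power2_eq_square algebra_simps)
  also have "\<dots> \<le> 3 * ((norm a)\<^sup>2 + (norm b)\<^sup>2 + (norm c)\<^sup>2)"
    by (simp only: diff_le_eq le_add_same_cancel1) (intro add_nonneg_nonneg zero_le_power2)
  finally show ?thesis .
qed

text \<open>Output injection: with L the transpose of the gain for the dual pair, A - L Q is stable
  and x obeys a recursion with this matrix, driven by L Q x + B u + w. The stage cost controls Q x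
  because Q is semidefinite and u because R is definite.\<close>

lemma detectable_state_bound:
  fixes A :: "real^'n^'n" and B :: "real^'d^'n"
  assumes Q: "pos_semidef Q" and R: "pos_def R" and "detectable A Q"
  obtains C where "C \<ge> 0"
    "\<And>x u w T. (\<And>t. t < T \<Longrightarrow> x (Suc t) = A *v x t + B *v u t + w t) \<Longrightarrow>
      (\<Sum>t<T. (norm (x t))\<^sup>2) \<le> C * ((norm (x 0))\<^sup>2
        + (\<Sum>t<T. x t \<bullet> (Q *v x t) + u t \<bullet> (R *v u t)) + (\<Sum>t<T. (norm (w t))\<^sup>2))"
proof -
  obtain K where "spectral_radius (transpose A - Q ** K) < 1"
    using assms(3) unfolding detectable_def stabilizable_def by blast
  define L where "L = transpose K"
  define G where "G = transpose (transpose A - Q ** K)"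
  have sym: "transpose Q = Q" and psd: "0 \<le> v \<bullet> (Q *v v)" for v
    using Q by (auto simp: pos_semidef_def)
  have "transpose (X - Y) = transpose X - transpose Y" for X Y :: "real^'n^'n"
    by (simp add: transpose_def vec_eq_iff)
  then have G: "G = A - L ** Q"
    by (simp add: G_def L_def matrix_transpose_mul sym)
  have "power_stable G"
    unfolding G_def by (intro power_stable_transpose power_stableI) fact
  then obtain C where C: "C \<ge> 0" "\<And>y z T. (\<And>t. t < T \<Longrightarrow> y (Suc t) = G *v y t + z t)
      \<Longrightarrow> (\<Sum>t<T. (norm (y t))\<^sup>2) \<le> C * ((norm (y 0))\<^sup>2 + (\<Sum>t<T. (norm (z t))\<^sup>2))"
    using power_stable_recursion by metis
  obtain cR where cR: "cR \<ge> 0" "\<And>u. (norm u)\<^sup>2 \<le> cR * (u \<bullet> (R *v u))"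
    using pos_def_bounded_below[OF R] by blast
  have Rpsd: "0 \<le> v \<bullet> (R *v v)" for v
    using pos_def_imp_pos_semidef[OF R] by (auto simp: pos_semidef_def)
  define a where "a = (spectral_norm L)\<^sup>2 * (spectral_norm Q + 1)"
  define b where "b = (spectral_norm B)\<^sup>2 * cR"
  have a: "0 \<le> a" and b: "0 \<le> b" using cR(1) spectral_norm_ge_0[of Q] by (auto simp: a_def b_def)
  define c where "c = 3 * (a + b + 1)"
  have z: "(norm (L *v (Q *v x) + B *v u + w))\<^sup>2 \<le> c * (x \<bullet> (Q *v x) + u \<bullet> (R *v u) + (norm w)\<^sup>2)" for x u w
  proof -
    have 1: "(norm (L *v (Q *v x)))\<^sup>2 \<le> a * (x \<bullet> (Q *v x))"
      using power_mono[OF norm_matrix_vector_le[of L "Q *v x"], of 2]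
        mult_left_mono[OF pos_semidef_norm_le[OF Q, of x], of "(spectral_norm L)\<^sup>2"]
      by (simp add: power_mult_distrib a_def mult_ac)
    have 2: "(norm (B *v u))\<^sup>2 \<le> b * (u \<bullet> (R *v u))"
      using power_mono[OF norm_matrix_vector_le[of B u], of 2]
        mult_left_mono[OF cR(2)[of u], of "(spectral_norm B)\<^sup>2"]
      by (simp add: power_mult_distrib b_def mult_ac)
    have "(norm (L *v (Q *v x) + B *v u + w))\<^sup>2 \<le> 3 * (a * (x \<bullet> (Q *v x)) + b * (u \<bullet> (R *v u)) + 1 * (norm w)\<^sup>2)"
      by (rule order_trans[OF norm_add3_power2_le]) (use 1 2 in simp)
    also have "\<dots> \<le> 3 * ((a + b + 1) * (x \<bullet> (Q *v x)) + (a + b + 1) * (u \<bullet> (R *v u)) + (a + b + 1) * (norm w)\<^sup>2)"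
      by (intro mult_left_mono add_mono mult_right_mono psd Rpsd) (use a b in auto)
    finally show ?thesis by (simp add: c_def algebra_simps)
  qed
  define D where "D = C * (c + 1)"
  have "c \<ge> 0" using a b by (simp add: c_def)
  show ?thesis
  proof (rule that)
    show "D \<ge> 0" using C(1) \<open>c \<ge> 0\<close> by (simp add: D_def)
    fix x u w T
    assume rec: "\<And>t. t < T \<Longrightarrow> x (Suc t) = A *v x t + B *v u t + w t"
    define S where "S = (\<Sum>t<T. x t \<bullet> (Q *v x t) + u t \<bullet> (R *v u t)) + (\<Sum>t<T. (norm (w t))\<^sup>2)"
    have "S \<ge> 0" unfolding S_def by (intro add_nonneg_nonneg sum_nonneg psd Rpsd) auto
    have "x (Suc t) = G *v x t + (L *v (Q *v x t) + B *v u t + w t)" if "t < T" for t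
      using rec[OF that] by (simp add: G matrix_vector_mult_diff_rdistrib matrix_vector_mul_assoc)
    then have "(\<Sum>t<T. (norm (x t))\<^sup>2) \<le> C * ((norm (x 0))\<^sup>2 +
        (\<Sum>t<T. (norm (L *v (Q *v x t) + B *v u t + w t))\<^sup>2))"
      by (rule C(2))
    also have "\<dots> \<le> C * ((norm (x 0))\<^sup>2 + (\<Sum>t<T. c * (x t \<bullet> (Q *v x t) + u t \<bullet> (R *v u t) + (norm (w t))\<^sup>2)))"
      by (intro mult_left_mono add_left_mono sum_mono z C(1))
    also have "(\<Sum>t<T. c * (x t \<bullet> (Q *v x t) + u t \<bullet> (R *v u t) + (norm (w t))\<^sup>2)) = c * S"
      by (simp add: S_def sum.distrib sum_distrib_left distrib_left)
    also have "C * ((norm (x 0))\<^sup>2 + c * S) \<le> C * ((c + 1) * (norm (x 0))\<^sup>2 + (c + 1) * S)"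
      using \<open>c \<ge> 0\<close> \<open>S \<ge> 0\<close> by (intro mult_left_mono add_mono C(1)) (auto simp: algebra_simps)
    finally show "(\<Sum>t<T. (norm (x t))\<^sup>2) \<le> D * ((norm (x 0))\<^sup>2
        + (\<Sum>t<T. x t \<bullet> (Q *v x t) + u t \<bullet> (R *v u t)) + (\<Sum>t<T. (norm (w t))\<^sup>2))"
      by (simp add: S_def D_def algebra_simps)
  qed
qed

section \<open>Completing the square and truncated costates\<close>

lemma exists_small_term:
  fixes f :: "nat \<Rightarrow> real"
  assumes "1 \<le> m" "m \<le> T" "\<And>t. f t \<ge> 0" "(\<Sum>t<T. f t) \<le> a"
  shows "\<exists>S<T. T - m \<le> S \<and> f S \<le> a / real m"
proof (rule ccontr)
  assume "\<not> ?thesis"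
  then have "a / real m < f S" if "S \<in> {T - m..<T}" for S using that by auto
  then have "(\<Sum>S\<in>{T - m..<T}. a / real m) < (\<Sum>S\<in>{T - m..<T}. f S)"
    using assms(1,2) by (intro sum_strict_mono) auto
  also have "\<dots> \<le> (\<Sum>t<T. f t)"
    using assms(3) by (intro sum_mono2) auto
  finally show False using assms by simp
qed

section \<open>Riccati identities and the completed square\<close>

locale lqr =
  fixes A :: "real^'n^'n" and B :: "real^'d^'n" and Q P :: "real^'n^'n" and R :: "real^'d^'d"
  assumes Q: "pos_semidef Q" and R: "pos_def R" and detectable: "detectable A Q"
    and P: "pos_semidef P" and dare: "dare A B Q R P"
begin

definition "K = lqr_gain A B R P"
definition "M = R + transpose B ** P ** B"
definition "G = matrix_inv M ** transpose B"
definition "F = A - B ** K"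

lemma P_sym: "transpose P = P" and P_psd: "0 \<le> x \<bullet> (P *v x)"
  using P by (auto simp: pos_semidef_def)

lemma Q_psd: "0 \<le> x \<bullet> (Q *v x)"
  using Q by (auto simp: pos_semidef_def)

lemma R_sym: "transpose R = R" and R_psd: "0 \<le> u \<bullet> (R *v u)"
  using pos_def_imp_pos_semidef[OF R] by (auto simp: pos_semidef_def)

lemma M_form: "h \<bullet> (M *v h') = h \<bullet> (R *v h') + (B *v h) \<bullet> (P *v (B *v h'))"
  by (simp add: M_def matrix_vector_mult_add_rdistrib inner_add_right inner_transpose
      matrix_vector_mul_assoc[symmetric] del: transpose_matrix_vector)

lemma M_symmetric: "h \<bullet> (M *v h') = h' \<bullet> (M *v h)"
  by (simp add: M_form inner_symmetric_matrix[OF R_sym, of h] inner_symmetric_matrix[OF P_sym, of "B *v h"])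

lemma M_psd: "0 \<le> h \<bullet> (M *v h)"
  by (simp add: M_form R_psd P_psd)

text \<open>M is positive definite since R is, hence invertible. This equation is the only place
  where \<open>matrix_inv\<close> is used as an inverse.\<close>

lemma M_G: "M *v (G *v p) = transpose B *v p"
proof -
  have "M *v h \<noteq> 0" if "h \<noteq> 0" for h
  proof -
    have "0 < h \<bullet> (M *v h)"
      using R that P_psd[of "B *v h"] unfolding M_form pos_def_def by (simp add: add_pos_nonneg)
    then show ?thesis by auto
  qed
  then have "inj ((*v) M)" by (subst linear_injective_0) auto
  then have "invertible M" by (simp add: invertible_left_inverse matrix_left_invertible_injective)
  then have "M ** matrix_inv M = mat 1"
    unfolding matrix_inv_def invertible_def by (rule someI2_ex) blast
  then show ?thesis
    by (simp add: G_def matrix_vector_mul_assoc matrix_mul_assoc del: transpose_matrix_vector)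
qed

lemma M_G_form: "h \<bullet> (M *v (G *v p)) = (B *v h) \<bullet> p"
  by (simp add: M_G inner_transpose del: transpose_matrix_vector)

lemma K_apply: "K *v x = G *v (P *v (A *v x))"
  by (simp add: K_def lqr_gain_def G_def M_def matrix_vector_mul_assoc matrix_mul_assoc)

lemma F_apply: "F *v x = A *v x - B *v (K *v x)"
  by (simp add: F_def matrix_vector_mult_diff_rdistrib matrix_vector_mul_assoc)

text \<open>Stationarity of the optimal feedback, B^T P F = R K, which is M K = B^T P A after
  splitting M.\<close>

lemma P_F_form: "(B *v h) \<bullet> (P *v (F *v x)) = h \<bullet> (R *v (K *v x))"
  using M_G_form[of h "P *v (A *v x)"]
  by (simp add: F_apply matrix_vector_mult_diff_distrib inner_diff_right M_form K_apply[symmetric])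

text \<open>The Riccati equation in Lyapunov form: it reads P = Q + A^T P F, and A = F + B K
  together with stationarity produces the K^T R K term.\<close>

lemma P_closed_loop:
  "x \<bullet> (P *v x) = x \<bullet> (Q *v x) + (K *v x) \<bullet> (R *v (K *v x)) + (F *v x) \<bullet> (P *v (F *v x))"
proof -
  have "P = Q + transpose A ** P ** A - transpose A ** P ** B ** K"
    using dare by (simp add: dare_def K_def)
  then have "x \<bullet> (P *v x) = x \<bullet> ((Q + transpose A ** P ** A - transpose A ** P ** B ** K) *v x)"
    by simp
  also have "\<dots> = x \<bullet> (Q *v x) + (A *v x) \<bullet> (P *v (A *v x)) - (A *v x) \<bullet> (P *v (B *v (K *v x)))"
    by (simp add: matrix_vector_mult_add_rdistrib matrix_vector_mult_diff_rdistrib inner_add_right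
        inner_diff_right inner_transpose matrix_vector_mul_assoc[symmetric] del: transpose_matrix_vector)
  also have "\<dots> = x \<bullet> (Q *v x) + (A *v x) \<bullet> (P *v (F *v x))"
    by (simp add: F_apply matrix_vector_mult_diff_distrib inner_diff_right)
  also have "A *v x = F *v x + B *v (K *v x)" by (simp add: F_apply)
  finally show ?thesis by (simp add: inner_add_left P_F_form)
qed

text \<open>Substituting u = h - K x turns y into F x + B h + w. Stationarity and the Lyapunov form
  remove the quadratic terms that mix h and x; what remains in h is h . M h + 2 (B h) . p, minimal
  at h = - G p with value - (B (G p)) . p.\<close>

lemma completed_square_step:
  defines "stage x u \<equiv> x \<bullet> (Q *v x) + u \<bullet> (R *v u)"
  defines "residual x u p \<equiv> u + K *v x + G *v p"
  assumes p: "p = P *v w + q" and y: "y = A *v x + B *v u + w"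
  shows "stage x u + y \<bullet> (P *v y) + 2 * (y \<bullet> q) =
    x \<bullet> (P *v x) + 2 * ((F *v x) \<bullet> p) + (w \<bullet> (P *v w) + 2 * (w \<bullet> q) - (B *v (G *v p)) \<bullet> p)
    + residual x u p \<bullet> (M *v residual x u p)"
proof -
  define h where "h = u + K *v x"
  have u: "u = h - K *v x" by (simp add: h_def)
  have y': "y = F *v x + B *v h + w"
    by (simp add: y u F_apply matrix_vector_mult_diff_distrib)
  have "residual x u p = h + G *v p" by (simp add: residual_def h_def)
  then have "residual x u p \<bullet> (M *v residual x u p)
      = h \<bullet> (M *v h) + 2 * ((B *v h) \<bullet> p) + (B *v (G *v p)) \<bullet> p"
    using M_symmetric[of "G *v p" h]
    by (simp add: matrix_vector_right_distrib inner_add_left inner_add_right M_G_form)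
  moreover have "stage x u = x \<bullet> (Q *v x) + h \<bullet> (R *v h) - 2 * (h \<bullet> (R *v (K *v x)))
      + (K *v x) \<bullet> (R *v (K *v x))"
    using inner_symmetric_matrix[OF R_sym, of "K *v x" h]
    by (simp add: stage_def u matrix_vector_mult_diff_distrib inner_diff_left inner_diff_right)
  moreover have "y \<bullet> (P *v y) = (F *v x) \<bullet> (P *v (F *v x)) + (B *v h) \<bullet> (P *v (B *v h)) + w \<bullet> (P *v w)
      + 2 * (h \<bullet> (R *v (K *v x))) + 2 * ((F *v x) \<bullet> (P *v w)) + 2 * ((B *v h) \<bullet> (P *v w))"
    using inner_symmetric_matrix[OF P_sym, of "F *v x" "B *v h"]
      inner_symmetric_matrix[OF P_sym, of w "F *v x"] inner_symmetric_matrix[OF P_sym, of w "B *v h"]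
    by (simp add: y' matrix_vector_right_distrib inner_add_left inner_add_right P_F_form)
  moreover have "y \<bullet> q = (F *v x) \<bullet> q + (B *v h) \<bullet> q + w \<bullet> q"
    by (simp add: y' inner_add_left)
  ultimately show ?thesis
    by (simp add: P_closed_loop[of x] M_form p inner_add_right algebra_simps)
qed

text \<open>\<open>transpose F *v costate w t k\<close> is half the linear term of the optimal cost-to-go at time \<open>t\<close>
  when the disturbances after the next \<open>k\<close> ones vanish.\<close>

primrec costate :: "(nat \<Rightarrow> real^'n) \<Rightarrow> nat \<Rightarrow> nat \<Rightarrow> real^'n" where
  "costate w t 0 = 0"
| "costate w t (Suc k) = P *v w t + transpose F *v costate w (Suc t) k"

text \<open>The second summand is the error of truncating the costate after k disturbances: a
  costate hit by the k-th power of the transpose of F. This is the source of the factor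
  ||F^k||.\<close>

lemma costate_add:
  "costate w t (k + j) = costate w t k + matrix_power (transpose F) k *v costate w (t + k) j"
  by (induction k arbitrary: t)
    (simp_all add: matrix_vector_right_distrib matrix_vector_mul_assoc del: transpose_matrix_vector)

text \<open>Vanishes for the offline optimal control over S steps with terminal weight P, which
  reacts to all disturbances before S.\<close>

definition residual :: "(nat \<Rightarrow> real^'n) \<Rightarrow> nat \<Rightarrow> (nat \<Rightarrow> real^'n) \<Rightarrow> (nat \<Rightarrow> real^'d) \<Rightarrow> nat \<Rightarrow> real^'d" where
  "residual w S x u t = u t + K *v x t + G *v costate w t (S - t)"

text \<open>The minimal cost over S steps with terminal weight P when w is known in advance; the
  subtracted terms are the savings due to the feedforward controls - G p.\<close>

definition base_cost :: "real^'n \<Rightarrow> (nat \<Rightarrow> real^'n) \<Rightarrow> nat \<Rightarrow> real" where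
  "base_cost x0 w S = x0 \<bullet> (P *v x0) + 2 * ((F *v x0) \<bullet> costate w 0 S)
    + (\<Sum>t<S. w t \<bullet> (P *v w t) + 2 * (w t \<bullet> (transpose F *v costate w (Suc t) (S - Suc t)))
        - (B *v (G *v costate w t (S - t))) \<bullet> costate w t (S - t))"

lemma completed_square:
  assumes x: "\<And>t. t < S \<Longrightarrow> x (Suc t) = A *v x t + B *v u t + w t"
  shows "(\<Sum>t<S. x t \<bullet> (Q *v x t) + u t \<bullet> (R *v u t)) + x S \<bullet> (P *v x S)
    = base_cost (x 0) w S + (\<Sum>t<S. residual w S x u t \<bullet> (M *v residual w S x u t))"
proof -
  define V where "V t = x t \<bullet> (P *v x t) + 2 * ((F *v x t) \<bullet> costate w t (S - t))" for t
  define g where "g t = w t \<bullet> (P *v w t) + 2 * (w t \<bullet> (transpose F *v costate w (Suc t) (S - Suc t)))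
        - (B *v (G *v costate w t (S - t))) \<bullet> costate w t (S - t)" for t
  have step: "x t \<bullet> (Q *v x t) + u t \<bullet> (R *v u t) =
      V t - V (Suc t) + g t + residual w S x u t \<bullet> (M *v residual w S x u t)" if "t < S" for t
  proof -
    define p p' where "p = costate w t (S - t)" and "p' = costate w (Suc t) (S - Suc t)"
    \<comment> \<open>Both costates extend to the common end S, so one unfolding relates them. At
      time S the costate is 0, which leaves x S . P x S as the last value of V.\<close>
    have "S - t = Suc (S - Suc t)" using that by simp
    then have c: "p = P *v w t + transpose F *v p'"
      by (simp only: p_def p'_def costate.simps)
    show ?thesis
      using completed_square_step[OF c x[OF that]] inner_transpose[of "x (Suc t)" F p']
      unfolding V_def g_def residual_def p_def[symmetric] p'_def[symmetric] by linarith
  qed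
  have "(\<Sum>t<S. x t \<bullet> (Q *v x t) + u t \<bullet> (R *v u t))
      = (\<Sum>t<S. V t - V (Suc t) + g t + residual w S x u t \<bullet> (M *v residual w S x u t))"
    by (intro sum.cong step) auto
  also have "\<dots> = V 0 - V S + (\<Sum>t<S. g t) + (\<Sum>t<S. residual w S x u t \<bullet> (M *v residual w S x u t))"
    by (simp add: sum.distrib sum_lessThan_telescope')
  finally show ?thesis by (simp add: base_cost_def V_def g_def)
qed

text \<open>The term x . P x telescopes along the closed loop, so the feedback has total cost at
  most v . P v. Detectability then makes the squared norms of the state summable, and every orbit of
  F tends to 0.\<close>

lemma closed_loop_stable: "spectral_radius F < 1"
proof (rule spectral_radius_lt_1)
  fix v
  obtain C where C: "C \<ge> 0" "\<And>x u w T. (\<And>t. t < T \<Longrightarrow> x (Suc t) = A *v x t + B *v u t + w t) \<Longrightarrow>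
      (\<Sum>t<T. (norm (x t))\<^sup>2) \<le> C * ((norm (x 0))\<^sup>2
        + (\<Sum>t<T. x t \<bullet> (Q *v x t) + u t \<bullet> (R *v u t)) + (\<Sum>t<T. (norm (w t))\<^sup>2))"
    by (rule detectable_state_bound[where B=B, OF Q R detectable]) (rule that; (assumption | blast | iprover))
  define x where "x t = matrix_power F t *v v" for t
  define u where "u t = - (K *v x t)" for t
  have x_0: "x 0 = v" and x_Suc: "x (Suc t) = F *v x t" for t
    by (simp_all add: x_def matrix_vector_mul_assoc)
  then have rec: "x (Suc t) = A *v x t + B *v u t + 0" for t
    by (simp add: F_apply u_def matrix_vector_mult_minus)
  have cost: "(\<Sum>t<T. x t \<bullet> (Q *v x t) + u t \<bullet> (R *v u t)) = v \<bullet> (P *v v) - x T \<bullet> (P *v x T)" for T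
  proof (induction T)
    case (Suc T)
    then show ?case using P_closed_loop[of "x T"] by (simp add: x_Suc u_def matrix_vector_mult_minus)
  qed (simp add: x_0)
  have "(\<Sum>t<T. (norm (x t))\<^sup>2) \<le> C * ((norm v)\<^sup>2 + v \<bullet> (P *v v))" for T
  proof -
    have "(\<Sum>t<T. (norm (x t))\<^sup>2) \<le> C * ((norm v)\<^sup>2 + (v \<bullet> (P *v v) - x T \<bullet> (P *v x T)) + 0)"
      using C(2)[of T x u "\<lambda>_. 0", OF rec] by (simp add: cost x_0)
    also have "\<dots> \<le> C * ((norm v)\<^sup>2 + v \<bullet> (P *v v))"
      using P_psd[of "x T"] by (intro mult_left_mono C(1)) simp
    finally show ?thesis .
  qed
  then have "summable (\<lambda>t. (norm (x t))\<^sup>2)"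
    by (intro summableI_nonneg_bounded) auto
  from tendsto_real_sqrt[OF summable_LIMSEQ_zero[OF this]] have "(\<lambda>t. norm (x t)) \<longlonglongrightarrow> 0"
    by simp
  then show "(\<lambda>k. matrix_power F k *v v) \<longlonglongrightarrow> 0"
    unfolding x_def by (rule tendsto_norm_zero_cancel)
qed

text \<open>Read backwards from the fixed end t + k, the costate is a recursion with the stable
  matrix F^T and the bounded inputs P w, so its bound does not depend on k.\<close>

lemma costate_bound:
  obtains C where "C \<ge> 0"
    "\<And>w W t k. \<lbrakk>\<And>s. norm (w s) \<le> W; W \<ge> 0\<rbrakk> \<Longrightarrow> norm (costate w t k) \<le> C * W"
proof -
  have stable: "power_stable (transpose F)"
    using power_stable_transpose power_stableI closed_loop_stable by blast
  obtain C where C: "C \<ge> 0" "\<And>y z T Z t. \<lbrakk>\<And>t. t < T \<Longrightarrow> y (Suc t) = transpose F *v y t + z t;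
      \<And>t. t < T \<Longrightarrow> norm (z t) \<le> Z; Z \<ge> 0; t \<le> T\<rbrakk> \<Longrightarrow> norm (y t) \<le> C * (norm (y 0) + Z)"
    by (rule power_stable_recursion[OF stable]) (rule that; (assumption | blast | iprover))
  show ?thesis
  proof (rule that)
    show "C * spectral_norm P \<ge> 0" using C(1) spectral_norm_ge_0[of P] by simp
    fix w :: "nat \<Rightarrow> real^'n" and W t k
    assume w: "\<And>s. norm (w s) \<le> W" and "W \<ge> 0"
    have "norm (costate w (t + k - j) j) \<le> C * (norm (costate w (t + k - 0) 0) + spectral_norm P * W)"
      if "j \<le> k" for j
    proof (rule C(2)[where T=k and z="\<lambda>j. P *v w (t + k - Suc j)"])
      fix i assume "i < k"
      then have "Suc (t + k - Suc i) = t + k - i" by simp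
      then show "costate w (t + k - Suc i) (Suc i) = transpose F *v costate w (t + k - i) i + P *v w (t + k - Suc i)"
        by (simp del: transpose_matrix_vector)
      show "norm (P *v w (t + k - Suc i)) \<le> spectral_norm P * W"
        by (rule order_trans[OF norm_matrix_vector_le]) (intro mult_left_mono w spectral_norm_ge_0)
    qed (use that \<open>W \<ge> 0\<close> spectral_norm_ge_0[of P] in auto)
    from this[of k] show "norm (costate w t k) \<le> C * spectral_norm P * W" by (simp add: mult.assoc)
  qed
qed

section \<open>The controller with truncated costates\<close>

primrec mpc_state :: "real^'n \<Rightarrow> (nat \<Rightarrow> real^'n) \<Rightarrow> nat \<Rightarrow> nat \<Rightarrow> real^'n" where
  "mpc_state x0 w k 0 = x0"
| "mpc_state x0 w k (Suc t) =
    A *v mpc_state x0 w k t - B *v (K *v mpc_state x0 w k t + G *v costate w t k) + w t"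

definition mpc_control :: "real^'n \<Rightarrow> (nat \<Rightarrow> real^'n) \<Rightarrow> nat \<Rightarrow> nat \<Rightarrow> real^'d" where
  "mpc_control x0 w k t = - (K *v mpc_state x0 w k t + G *v costate w t k)"

lemma state_mpc: "state A B x0 (mpc_control x0 w k) w t = mpc_state x0 w k t"
  by (induction t) (simp_all add: mpc_control_def matrix_vector_mult_minus algebra_simps)

lemma costate_cong: "(\<And>s. t \<le> s \<Longrightarrow> s < t + k \<Longrightarrow> w s = w' s) \<Longrightarrow> costate w t k = costate w' t k"
  by (induction k arbitrary: t) simp_all

text \<open>The entries before t + k are those that the game has revealed when the control at time t
  is chosen. The costate at t reads entries t to t + k - 1, and the state reads only earlier
  costates and disturbances.\<close>

lemma mpc_control_nonanticipative:
  assumes "\<And>s. s < t + k \<Longrightarrow> w s = w' s"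
  shows "mpc_control x0 w k t = mpc_control x0 w' k t"
proof -
  have "mpc_state x0 w k i = mpc_state x0 w' k i" if "i \<le> t" for i
    using that
  proof (induction i)
    case (Suc i)
    moreover have "w i = w' i" using Suc.prems assms by simp
    moreover have "costate w i k = costate w' i k"
      using Suc.prems by (intro costate_cong assms) simp
    ultimately show ?case by simp
  qed simp
  then show ?thesis using costate_cong[of t k w w'] assms by (simp add: mpc_control_def)
qed

lemma mpc_bound:
  assumes "W \<ge> 0"
  obtains C where "C \<ge> 0" "\<And>w k t. (\<And>s. norm (w s) \<le> W) \<Longrightarrow> norm (mpc_state x0 w k t) \<le> C"
    "\<And>w k t. (\<And>s. norm (w s) \<le> W) \<Longrightarrow> norm (mpc_control x0 w k t) \<le> C"
proof -
  obtain Cp where Cp: "Cp \<ge> 0"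
    "\<And>w W t k. \<lbrakk>\<And>s. norm (w s) \<le> W; W \<ge> 0\<rbrakk> \<Longrightarrow> norm (costate w t k) \<le> Cp * W"
    by (rule costate_bound) (rule that; (assumption | blast | iprover))
  obtain C where C: "C \<ge> 0" "\<And>y z T Z t. \<lbrakk>\<And>t. t < T \<Longrightarrow> y (Suc t) = F *v y t + z t;
      \<And>t. t < T \<Longrightarrow> norm (z t) \<le> Z; Z \<ge> 0; t \<le> T\<rbrakk> \<Longrightarrow> norm (y t) \<le> C * (norm (y 0) + Z)"
    by (rule power_stable_recursion[OF power_stableI[OF closed_loop_stable]]) (rule that; (assumption | blast | iprover))
  define g where "g = spectral_norm G * (Cp * W)"
  define Z where "Z = spectral_norm B * g + W"
  define Cx where "Cx = C * (norm x0 + Z)"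
  have g: "norm (G *v costate w t k) \<le> g" if "\<And>s. norm (w s) \<le> W" for w t k
    unfolding g_def using that \<open>W \<ge> 0\<close>
    by (intro order_trans[OF norm_matrix_vector_le] mult_left_mono Cp(2) spectral_norm_ge_0)
  have "g \<ge> 0" using Cp(1) \<open>W \<ge> 0\<close> spectral_norm_ge_0[of G] by (simp add: g_def)
  then have "Z \<ge> 0" using \<open>W \<ge> 0\<close> spectral_norm_ge_0[of B] by (simp add: Z_def)
  have x: "norm (mpc_state x0 w k t) \<le> Cx" if w: "\<And>s. norm (w s) \<le> W" for w k t
  proof -
    have "norm (mpc_state x0 w k t) \<le> C * (norm (mpc_state x0 w k 0) + Z)"
    proof (rule C(2)[where T=t and z="\<lambda>t. - (B *v (G *v costate w t k)) + w t"])
      fix i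
      show "mpc_state x0 w k (Suc i) = F *v mpc_state x0 w k i + (- (B *v (G *v costate w i k)) + w i)"
        by (simp add: F_apply matrix_vector_right_distrib)
      have "norm (B *v (G *v costate w i k)) \<le> spectral_norm B * g"
        by (intro order_trans[OF norm_matrix_vector_le] mult_left_mono g w spectral_norm_ge_0)
      then show "norm (- (B *v (G *v costate w i k)) + w i) \<le> Z"
        unfolding Z_def by (intro norm_triangle_mono) (use w in auto)
    qed (use \<open>Z \<ge> 0\<close> in auto)
    then show ?thesis by (simp add: Cx_def)
  qed
  have u: "norm (mpc_control x0 w k t) \<le> spectral_norm K * Cx + g" if w: "\<And>s. norm (w s) \<le> W" for w k t
    unfolding mpc_control_def norm_minus_cancel
    by (intro norm_triangle_mono g w order_trans[OF norm_matrix_vector_le] mult_left_mono x spectral_norm_ge_0)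
  have "Cx \<ge> 0" using C(1) \<open>Z \<ge> 0\<close> by (simp add: Cx_def)
  show ?thesis
  proof (rule that)
    show "Cx + (spectral_norm K * Cx + g) \<ge> 0"
      using \<open>Cx \<ge> 0\<close> \<open>g \<ge> 0\<close> spectral_norm_ge_0[of K] by simp
    show "norm (mpc_state x0 w k t) \<le> Cx + (spectral_norm K * Cx + g)" if "\<And>s. norm (w s) \<le> W" for w k t
      using x[OF that] \<open>Cx \<ge> 0\<close> \<open>g \<ge> 0\<close> spectral_norm_ge_0[of K] by (simp add: add_increasing2)
    show "norm (mpc_control x0 w k t) \<le> Cx + (spectral_norm K * Cx + g)" if "\<And>s. norm (w s) \<le> W" for w k t
      using u[of w k t, OF that] \<open>Cx \<ge> 0\<close> by linarith
  qed
qed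

text \<open>The residual is G applied to a difference of two costates. For t + k \<le> S this is a
  truncation error; in the remaining steps, at most k, the controller looks past S and the residual
  is merely bounded, whence the summand \<open>real k\<close>.\<close>

lemma mpc_residual_bound:
  assumes "W \<ge> 0"
  obtains C where "C \<ge> 0" "\<And>w k S. (\<And>s. norm (w s) \<le> W) \<Longrightarrow>
    (\<Sum>t<S. residual w S (mpc_state x0 w k) (mpc_control x0 w k) t \<bullet>
      (M *v residual w S (mpc_state x0 w k) (mpc_control x0 w k) t))
    \<le> C * (real S * (spectral_norm (matrix_power F k))\<^sup>2 + real k)"
proof -
  obtain Cp where Cp: "Cp \<ge> 0"
    "\<And>w W t k. \<lbrakk>\<And>s. norm (w s) \<le> W; W \<ge> 0\<rbrakk> \<Longrightarrow> norm (costate w t k) \<le> Cp * W"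
    by (rule costate_bound) (rule that; (assumption | blast | iprover))
  define c where "c = spectral_norm G * (Cp * W)"
  \<comment> \<open>The 4 comes from squaring the crude bound 2 c near the end, where the two
    costates are estimated separately.\<close>
  define C where "C = 4 * spectral_norm M * c\<^sup>2"
  have "C \<ge> 0" using spectral_norm_ge_0[of M] by (simp add: C_def)
  have "c \<ge> 0" using Cp(1) \<open>W \<ge> 0\<close> spectral_norm_ge_0[of G] by (simp add: c_def)
  show ?thesis
  proof (rule that[OF \<open>C \<ge> 0\<close>])
    fix w :: "nat \<Rightarrow> real^'n" and k S
    assume w: "\<And>s. norm (w s) \<le> W"
    define r where "r = residual w S (mpc_state x0 w k) (mpc_control x0 w k)"
    define f where "f = spectral_norm (matrix_power F k)"
    have "f \<ge> 0" by (simp add: f_def spectral_norm_ge_0)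
    have r: "r t = G *v (costate w t (S - t) - costate w t k)" for t
      by (simp add: r_def residual_def mpc_control_def matrix_vector_mult_diff_distrib)
    have bound: "r t \<bullet> (M *v r t) \<le> C * f\<^sup>2 + (if t \<in> {S - k..<S} then C else 0)" if "t < S" for t
    proof (cases "t + k \<le> S")
      case True
      then obtain j where j: "S - t = k + j" by (metis add_le_imp_le_diff add.commute le_Suc_ex)
      have "norm (r t) \<le> spectral_norm G * (f * (Cp * W))"
      proof -
        have "costate w t (S - t) - costate w t k = transpose (matrix_power F k) *v costate w (t + k) j"
          by (simp add: j costate_add transpose_matrix_power del: transpose_matrix_vector)
        also have "norm \<dots> \<le> f * (Cp * W)"
          using \<open>f \<ge> 0\<close> unfolding f_def
          by (intro order_trans[OF norm_matrix_vector_le] mult_mono spectral_norm_transpose_le Cp w \<open>W \<ge> 0\<close>)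
            auto
        finally show ?thesis unfolding r
          by (intro order_trans[OF norm_matrix_vector_le] mult_left_mono spectral_norm_ge_0)
      qed
      then have "norm (r t) \<le> f * c" by (simp add: c_def mult_ac)
      then have "(norm (r t))\<^sup>2 \<le> (f * c)\<^sup>2" by (intro power_mono) auto
      then have "r t \<bullet> (M *v r t) \<le> spectral_norm M * (f * c)\<^sup>2"
        by (intro order_trans[OF quadratic_form_le] mult_left_mono spectral_norm_ge_0)
      also have "\<dots> \<le> C * f\<^sup>2"
        using spectral_norm_ge_0[of M] by (simp add: C_def power_mult_distrib)
      finally show ?thesis using \<open>C \<ge> 0\<close> by simp
    next
      case False
      have "norm (r t) \<le> spectral_norm G * (Cp * W + Cp * W)" unfolding r
        using w \<open>W \<ge> 0\<close>
        by (intro order_trans[OF norm_matrix_vector_le] mult_left_mono spectral_norm_ge_0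
            order_trans[OF norm_triangle_ineq4] add_mono Cp(2))
      then have "norm (r t) \<le> 2 * c" by (simp add: c_def algebra_simps)
      then have "(norm (r t))\<^sup>2 \<le> (2 * c)\<^sup>2" by (intro power_mono) auto
      then have "r t \<bullet> (M *v r t) \<le> spectral_norm M * (2 * c)\<^sup>2"
        by (intro order_trans[OF quadratic_form_le] mult_left_mono spectral_norm_ge_0)
      also have "\<dots> = C" by (simp add: C_def power_mult_distrib)
      finally show ?thesis using False that \<open>C \<ge> 0\<close> by (auto intro: add_increasing)
    qed
    have "(\<Sum>t<S. r t \<bullet> (M *v r t)) \<le> (\<Sum>t<S. C * f\<^sup>2 + (if t \<in> {S - k..<S} then C else 0))"
      by (intro sum_mono bound) auto
    also have "\<dots> = real S * (C * f\<^sup>2) + C * real (card ({..<S} \<inter> {S - k..<S}))"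
      unfolding sum.distrib by (subst sum.inter_restrict[symmetric]) simp_all
    also have "card ({..<S} \<inter> {S - k..<S}) \<le> k"
      using card_mono[of "{S - k..<S}" "{..<S} \<inter> {S - k..<S}"] by simp
    then have "real S * (C * f\<^sup>2) + C * real (card ({..<S} \<inter> {S - k..<S})) \<le> real S * (C * f\<^sup>2) + C * real k"
      using \<open>C \<ge> 0\<close> by (intro add_left_mono mult_left_mono) auto
    finally show "(\<Sum>t<S. r t \<bullet> (M *v r t)) \<le> C * (real S * f\<^sup>2 + real k)"
      by (simp add: algebra_simps)
  qed
qed

lemma mpc_cost_bound:
  assumes "W \<ge> 0"
  obtains C where "C \<ge> 0"
    "\<And>w k t. (\<And>s. norm (w s) \<le> W) \<Longrightarrow>
      mpc_state x0 w k t \<bullet> (Q *v mpc_state x0 w k t) + mpc_control x0 w k t \<bullet> (R *v mpc_control x0 w k t) \<le> C"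
    "\<And>w k t. (\<And>s. norm (w s) \<le> W) \<Longrightarrow> mpc_state x0 w k t \<bullet> (Qf *v mpc_state x0 w k t) \<le> C"
proof -
  obtain c where c: "c \<ge> 0" "\<And>w k t. (\<And>s. norm (w s) \<le> W) \<Longrightarrow> norm (mpc_state x0 w k t) \<le> c"
    "\<And>w k t. (\<And>s. norm (w s) \<le> W) \<Longrightarrow> norm (mpc_control x0 w k t) \<le> c"
    by (rule mpc_bound[OF assms]) (rule that; (assumption | blast | iprover))
  have form: "y \<bullet> (X *v y) \<le> spectral_norm X * c\<^sup>2" if "norm y \<le> c" for X :: "real^'m^'m" and y
    using that by (intro order_trans[OF quadratic_form_le] mult_left_mono spectral_norm_ge_0 power_mono) auto
  show ?thesis
  proof (rule that)
    let ?C = "(spectral_norm Q + spectral_norm R + spectral_norm Qf) * c\<^sup>2"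
    show "?C \<ge> 0" using spectral_norm_ge_0[of Q] spectral_norm_ge_0[of R] spectral_norm_ge_0[of Qf] by simp
    fix w :: "nat \<Rightarrow> real^'n" and k t
    assume w: "\<And>s. norm (w s) \<le> W"
    note pos = spectral_norm_ge_0[of Q] spectral_norm_ge_0[of R] spectral_norm_ge_0[of Qf]
    have pos': "0 \<le> spectral_norm Q * c\<^sup>2" "0 \<le> spectral_norm R * c\<^sup>2" "0 \<le> spectral_norm Qf * c\<^sup>2"
      using pos by simp_all
    show "mpc_state x0 w k t \<bullet> (Q *v mpc_state x0 w k t) + mpc_control x0 w k t \<bullet> (R *v mpc_control x0 w k t) \<le> ?C"
      using form[OF c(2)[of w k t, OF w], of Q] form[OF c(3)[of w k t, OF w], of R] pos'
      by (simp only: distrib_right)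
    show "mpc_state x0 w k t \<bullet> (Qf *v mpc_state x0 w k t) \<le> ?C"
      using form[OF c(2)[of w k t, OF w], of Qf] pos' by (simp only: distrib_right)
  qed
qed

text \<open>Both costs are compared with \<open>base_cost x0 w S\<close>. Of the error terms, the
  first two come from the controller's residuals, m from what it pays after S including the terminal
  cost, and T / m from the competitor's x S . P x S.\<close>

lemma mpc_near_optimal:
  assumes "W \<ge> 0" and Qf: "pos_semidef Qf"
  obtains C where "C \<ge> 0"
    "\<And>w k T. (\<And>s. norm (w s) \<le> W) \<Longrightarrow>
      lqr_cost A B Q R Qf x0 T (mpc_control x0 w k) w \<le> C * (real T + 1)"
    "\<And>w k T m u. \<lbrakk>\<And>s. norm (w s) \<le> W; 1 \<le> m; m \<le> T\<rbrakk> \<Longrightarrow>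
      lqr_cost A B Q R Qf x0 T (mpc_control x0 w k) w \<le> lqr_cost A B Q R Qf x0 T u w
        + C * (real T * (spectral_norm (matrix_power F k))\<^sup>2 + real k + real m + real T / real m)"
proof -
  obtain C1 where C1: "C1 \<ge> 0" "\<And>w k t. (\<And>s. norm (w s) \<le> W) \<Longrightarrow>
      mpc_state x0 w k t \<bullet> (Q *v mpc_state x0 w k t) + mpc_control x0 w k t \<bullet> (R *v mpc_control x0 w k t) \<le> C1"
    "\<And>w k t. (\<And>s. norm (w s) \<le> W) \<Longrightarrow> mpc_state x0 w k t \<bullet> (Qf *v mpc_state x0 w k t) \<le> C1"
    by (rule mpc_cost_bound[OF \<open>W \<ge> 0\<close>, of x0 Qf]) (rule that; (assumption | blast | iprover))
  obtain C2 where C2: "C2 \<ge> 0" "\<And>w k S. (\<And>s. norm (w s) \<le> W) \<Longrightarrow>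
    (\<Sum>t<S. residual w S (mpc_state x0 w k) (mpc_control x0 w k) t \<bullet>
      (M *v residual w S (mpc_state x0 w k) (mpc_control x0 w k) t))
    \<le> C2 * (real S * (spectral_norm (matrix_power F k))\<^sup>2 + real k)"
    by (rule mpc_residual_bound[OF \<open>W \<ge> 0\<close>, of x0]) (rule that; (assumption | blast | iprover))
  obtain C3 where C3: "C3 \<ge> 0" "\<And>x u w T. (\<And>t. t < T \<Longrightarrow> x (Suc t) = A *v x t + B *v u t + w t) \<Longrightarrow>
      (\<Sum>t<T. (norm (x t))\<^sup>2) \<le> C3 * ((norm (x 0))\<^sup>2
        + (\<Sum>t<T. x t \<bullet> (Q *v x t) + u t \<bullet> (R *v u t)) + (\<Sum>t<T. (norm (w t))\<^sup>2))"
    by (rule detectable_state_bound[where B=B, OF Q R detectable]) (rule that; (assumption | blast | iprover))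
  have Qf_psd: "0 \<le> x \<bullet> (Qf *v x)" for x using Qf by (auto simp: pos_semidef_def)
  \<comment> \<open>C4 T bounds the sum of squared states of any competitor cheaper than the
    controller; 1 \<le> T and T + 1 \<le> 2 T make all contributions linear in T.\<close>
  define C4 where "C4 = C3 * ((norm x0)\<^sup>2 + 2 * C1 + W\<^sup>2)"
  define C where "C = 2 * C1 + C2 + spectral_norm P * C4"
  have "C4 \<ge> 0" using C3(1) C1(1) by (simp add: C4_def)
  then have PC4: "spectral_norm P * C4 \<ge> 0" using spectral_norm_ge_0[of P] by simp
  have C_ge: "2 * C1 \<le> C" "C2 \<le> C" "spectral_norm P * C4 \<le> C" "0 \<le> C"
    using C1(1) C2(1) PC4 by (auto simp: C_def)
  have cost_le: "lqr_cost A B Q R Qf x0 T (mpc_control x0 w k) w \<le> C1 * (real T + 1)"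
    if w: "\<And>s. norm (w s) \<le> W" for w k T
  proof -
    have "lqr_cost A B Q R Qf x0 T (mpc_control x0 w k) w \<le> (\<Sum>t<T. C1) + C1"
      unfolding lqr_cost_def state_mpc by (intro add_mono sum_mono C1 w)
    then show ?thesis by (simp add: algebra_simps)
  qed
  show ?thesis
  proof (rule that[OF C_ge(4)])
    show "lqr_cost A B Q R Qf x0 T (mpc_control x0 w k) w \<le> C * (real T + 1)"
      if w: "\<And>s. norm (w s) \<le> W" for w k T
      using C_ge(1) C1(1) by (intro order_trans[OF cost_le[OF w]] mult_right_mono) auto
    fix w :: "nat \<Rightarrow> real^'n" and k T m :: nat and u :: "nat \<Rightarrow> real^'d"
    assume w: "\<And>s. norm (w s) \<le> W" and m: "1 \<le> m" "m \<le> T"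
    define f where "f = (spectral_norm (matrix_power F k))\<^sup>2"
    have "f \<ge> 0" by (simp add: f_def)
    define J where "J v = lqr_cost A B Q R Qf x0 T v w" for v
    define \<pi> where "\<pi> = mpc_control x0 w k"
    define x where "x = state A B x0 u w"
    define y where "y = mpc_state x0 w k"
    define c where "c t = x t \<bullet> (Q *v x t) + u t \<bullet> (R *v u t)" for t
    define d where "d t = y t \<bullet> (Q *v y t) + \<pi> t \<bullet> (R *v \<pi> t)" for t
    have c_nonneg: "c t \<ge> 0" for t by (simp add: c_def Q_psd R_psd)
    have J_u: "J u = (\<Sum>t<T. c t) + x T \<bullet> (Qf *v x T)"
      by (simp add: J_def lqr_cost_def c_def x_def)
    have J_\<pi>: "J \<pi> = (\<Sum>t<T. d t) + y T \<bullet> (Qf *v y T)"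
      by (simp add: J_def \<pi>_def lqr_cost_def d_def y_def state_mpc)
    show "J \<pi> \<le> J u + C * (real T * f + real k + real m + real T / real m)"
    proof (cases "J \<pi> \<le> J u")
      case True
      then show ?thesis using C_ge(4) \<open>f \<ge> 0\<close> by (simp add: add_increasing2)
    next
      \<comment> \<open>A competitor cheaper than the controller inherits its linear cost bound,
        which is what detectability needs to yield a small state near the end.\<close>
      case False
      have "(\<Sum>t<T. c t) \<le> J u" using J_u Qf_psd[of "x T"] by simp
      also have "\<dots> \<le> C1 * (real T + 1)" using False cost_le[of w T k, OF w] by (simp add: J_def \<pi>_def)
      also have "\<dots> \<le> C1 * (2 * real T)" using m C1(1) by (intro mult_left_mono) auto
      finally have sum_c: "(\<Sum>t<T. c t) \<le> 2 * C1 * real T" by simp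
      have x_rec: "x (Suc t) = A *v x t + B *v u t + w t" for t by (simp add: x_def)
      have "(\<Sum>t<T. (norm (x t))\<^sup>2) \<le> C3 * ((norm (x 0))\<^sup>2 + (\<Sum>t<T. c t) + (\<Sum>t<T. (norm (w t))\<^sup>2))"
        unfolding c_def by (rule C3(2)) (rule x_rec)
      also have "\<dots> \<le> C3 * ((norm x0)\<^sup>2 * real T + 2 * C1 * real T + (\<Sum>t<T. W\<^sup>2))"
      proof -
        have "(norm (x 0))\<^sup>2 * 1 \<le> (norm x0)\<^sup>2 * real T"
          unfolding x_def state.simps by (rule mult_left_mono) (use m in auto)
        moreover have "(\<Sum>t<T. (norm (w t))\<^sup>2) \<le> (\<Sum>t<T. W\<^sup>2)"
          by (intro sum_mono power_mono w) simp
        ultimately show ?thesis using sum_c by (intro mult_left_mono C3(1)) linarith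
      qed
      also have "\<dots> = C4 * real T" by (simp add: C4_def algebra_simps)
      finally obtain S where S: "S < T" "T - m \<le> S" and xS: "(norm (x S))\<^sup>2 \<le> C4 * real T / real m"
        using exists_small_term[OF m, of "\<lambda>t. (norm (x t))\<^sup>2" "C4 * real T"] by auto
      have split: "(\<Sum>t<T. h t) = (\<Sum>t<S. h t) + (\<Sum>t\<in>{S..<T}. h t)" for h :: "nat \<Rightarrow> real"
        using S(1) by (metis atLeast0LessThan le0 less_imp_le sum.atLeastLessThan_concat)
      \<comment> \<open>The competitor's residuals and its cost after S are dropped as nonnegative;
        x S . P x S, absent from its cost before S, is small by the choice of S.\<close>
      have "base_cost x0 w S - spectral_norm P * (C4 * real T / real m)
          \<le> base_cost x0 w S - x S \<bullet> (P *v x S)"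
        using order_trans[OF quadratic_form_le[of "x S" P] mult_left_mono[OF xS spectral_norm_ge_0[of P]]]
        by simp
      also have "\<dots> \<le> base_cost x0 w S - x S \<bullet> (P *v x S)
          + (\<Sum>t<S. residual w S x u t \<bullet> (M *v residual w S x u t))"
        by (simp add: sum_nonneg M_psd)
      also have "\<dots> = (\<Sum>t<S. c t)"
        using completed_square[of S x u w] x_rec by (simp add: c_def x_def)
      also have "\<dots> \<le> J u"
        unfolding J_u split using Qf_psd[of "x T"] sum_nonneg[of "{S..<T}" c] c_nonneg by simp
      finally have lower: "base_cost x0 w S \<le> J u + spectral_norm P * C4 * (real T / real m)"
        by simp
      have "y (Suc t) = A *v y t + B *v \<pi> t + w t" for t
        by (simp add: y_def \<pi>_def mpc_control_def matrix_vector_mult_minus algebra_simps)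
      then have "(\<Sum>t<S. d t) + y S \<bullet> (P *v y S)
          = base_cost x0 w S + (\<Sum>t<S. residual w S y \<pi> t \<bullet> (M *v residual w S y \<pi> t))"
        using completed_square[of S y \<pi> w] by (simp add: d_def) (simp add: y_def)
      also have "\<dots> \<le> base_cost x0 w S + C2 * (real S * f + real k)"
        unfolding y_def \<pi>_def f_def by (intro add_left_mono C2(2) w)
      also have "\<dots> \<le> base_cost x0 w S + C2 * (real T * f + real k)"
        using S C2(1) \<open>f \<ge> 0\<close> by (intro add_left_mono mult_left_mono add_right_mono mult_right_mono) auto
      finally have upper: "(\<Sum>t<S. d t) \<le> base_cost x0 w S + C2 * (real T * f + real k)"
        using P_psd[of "y S"] by simp
      \<comment> \<open>After S the controller pays at most C1 per step for at most m steps.\<close>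
      have "(\<Sum>t\<in>{S..<T}. d t) \<le> (\<Sum>t\<in>{S..<T}. C1)"
        unfolding d_def y_def \<pi>_def by (intro sum_mono C1(2) w)
      also have "\<dots> \<le> C1 * real m" using S C1(1) by (simp add: mult.commute mult_left_mono)
      finally have tail: "(\<Sum>t\<in>{S..<T}. d t) + y T \<bullet> (Qf *v y T) \<le> C1 * real m + C1"
        unfolding y_def by (intro add_mono C1(3) w)
      have "J \<pi> \<le> J u + (spectral_norm P * C4 * (real T / real m) + C2 * (real T * f + real k) + (C1 * real m + C1))"
        unfolding J_\<pi> split using upper tail lower by linarith
      also have "\<dots> \<le> J u + (C * (real T / real m) + C * (real T * f + real k) + C * real m)"
      proof -
        have "C1 * real m + C1 \<le> 2 * C1 * real m"
          using C1(1) m mult_left_mono[of 1 "real m" C1] by simp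
        also have "\<dots> \<le> C * real m" by (intro mult_right_mono C_ge) auto
        finally show ?thesis
          using C_ge \<open>f \<ge> 0\<close> by (intro add_left_mono add_mono mult_right_mono) auto
      qed
      finally show ?thesis by (simp add: algebra_simps)
    qed
  qed
qed

end

section \<open>The game with predictions\<close>

text \<open>The adversary may commit to \<open>w0\<close> whatever the controls are, so each
  supremum is at least its value at the next entry of \<open>w0\<close>. Letting the controls know
  all of \<open>w0\<close> only lowers the cost further.\<close>

lemma adv_rounds_ge:
  assumes cong: "\<And>u u' w w'. (\<And>t. t < T \<Longrightarrow> u t = u' t) \<Longrightarrow> (\<And>t. t < T \<Longrightarrow> w t = w' t) \<Longrightarrow> J u w = J u' w'"
    and w0: "\<And>t. t < T \<Longrightarrow> w0 t \<in> \<Omega>"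
    and "r \<le> T" "\<And>t. t < T - r \<Longrightarrow> w t = w0 t"
  shows "(INF u. ereal (J u w0)) \<le> adv_rounds J \<Omega> T k r u w"
  using assms(3,4)
proof (induction r arbitrary: u w)
  case 0
  then have "J v w = J v w0" for v by (intro cong) auto
  then show ?case by (auto intro!: INF_greatest INF_lower)
next
  case (Suc r)
  let ?w = "w(T - Suc r := w0 (T - Suc r))"
  have "(INF u. ereal (J u w0)) \<le> adv_rounds J \<Omega> T k r (u(T - k - Suc r := a)) ?w" for a
  proof (rule Suc.IH)
    fix t assume "t < T - r"
    then show "?w t = w0 t" using Suc.prems by (cases "t = T - Suc r") auto
  qed (use Suc.prems in simp)
  moreover have "w0 (T - Suc r) \<in> \<Omega>" using Suc.prems by (intro w0) simp
  ultimately show ?case by (auto intro!: INF_greatest SUP_upper2)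
qed

text \<open>Playing \<open>\<pi>\<close> bounds each infimum. The invariant is that the controls
  fixed so far are those \<open>\<pi>\<close> assigns to the current w; \<open>k + r \<le> T\<close>
  keeps the subtractions in the indices exact.\<close>

lemma adv_rounds_le:
  assumes cong: "\<And>u u' w w'. (\<And>t. t < T \<Longrightarrow> u t = u' t) \<Longrightarrow> (\<And>t. t < T \<Longrightarrow> w t = w' t) \<Longrightarrow> J u w = J u' w'"
    and nonanticipative: "\<And>w w' t. (\<And>s. s < t + k \<Longrightarrow> w s = w' s) \<Longrightarrow> \<pi> w t = \<pi> w' t"
    and Z: "\<And>w. (\<And>t. t < T \<Longrightarrow> w t \<in> \<Omega>) \<Longrightarrow> ereal (J (\<pi> w) w) \<le> Z"
    and "k + r \<le> T" "\<And>t. t < T - r \<Longrightarrow> w t \<in> \<Omega>" "\<And>t. t < T - k - r \<Longrightarrow> u t = \<pi> w t"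
  shows "adv_rounds J \<Omega> T k r u w \<le> Z"
  using assms(4-)
proof (induction r arbitrary: u w)
  case 0
  have "J (override_on u (\<pi> w) {T - k..<T}) w = J (\<pi> w) w"
    using 0 by (intro cong) (auto simp: override_on_def)
  then have "ereal (J (override_on u (\<pi> w) {T - k..<T}) w) \<le> Z"
    using Z[of w] 0 by simp
  then show ?case by (auto intro: INF_lower2)
next
  case (Suc r)
  let ?u = "u(T - k - Suc r := \<pi> w (T - k - Suc r))"
  have "adv_rounds J \<Omega> T k r ?u (w(T - Suc r := b)) \<le> Z" if "b \<in> \<Omega>" for b
  proof (rule Suc.IH)
    let ?w = "w(T - Suc r := b)"
    show "?w t \<in> \<Omega>" if "t < T - r" for t
      using that Suc.prems \<open>b \<in> \<Omega>\<close> by (cases "t = T - Suc r") auto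
    show "?u t = \<pi> ?w t" if "t < T - k - r" for t
    proof -
      have "?u t = \<pi> w t" using that Suc.prems by (cases "t = T - k - Suc r") auto
      \<comment> \<open>Here t + k \<le> T - Suc r, so the window of known disturbances ends just
        before the entry chosen in this round.\<close>
      also have "\<dots> = \<pi> ?w t" using that by (intro nonanticipative) auto
      finally show ?thesis .
    qed
  qed (use Suc.prems in simp)
  then have "(SUP b\<in>\<Omega>. adv_rounds J \<Omega> T k r ?u (w(T - Suc r := b))) \<le> Z"
    by (intro SUP_least)
  then show ?case by (auto intro: INF_lower2)
qed

lemma lqr_cost_cong:
  assumes "\<And>t. t < T \<Longrightarrow> u t = u' t" "\<And>t. t < T \<Longrightarrow> w t = w' t"
  shows "lqr_cost A B Q R Qf x0 T u w = lqr_cost A B Q R Qf x0 T u' w'"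
proof -
  have "state A B x0 u w t = state A B x0 u' w' t" if "t \<le> T" for t
    using that by (induction t) (simp_all add: assms)
  then show ?thesis by (simp add: lqr_cost_def assms)
qed

lemma adv_cost_horizon_ge:
  assumes "k \<le> T" "\<And>t. t < T \<Longrightarrow> w t \<in> \<Omega>"
  shows "(INF u. ereal (lqr_cost A B Q R Qf x0 T u w)) \<le> adv_cost_horizon A B Q R Qf x0 \<Omega> k T"
  unfolding adv_cost_horizon_def
proof (rule SUP_upper2)
  show "restrict w {..<k} \<in> {..<k} \<rightarrow>\<^sub>E \<Omega>" using assms by auto
  show "(INF u. ereal (lqr_cost A B Q R Qf x0 T u w))
      \<le> adv_rounds (lqr_cost A B Q R Qf x0 T) \<Omega> T k (T - k) (\<lambda>_. 0) (restrict w {..<k})"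
    using assms by (intro adv_rounds_ge lqr_cost_cong) auto
qed

lemma adv_cost_horizon_le:
  assumes "k \<le> T"
    and "\<And>w w' t. (\<And>s. s < t + k \<Longrightarrow> w s = w' s) \<Longrightarrow> \<pi> w t = \<pi> w' t"
    and "\<And>w. (\<And>t. t < T \<Longrightarrow> w t \<in> \<Omega>) \<Longrightarrow> ereal (lqr_cost A B Q R Qf x0 T (\<pi> w) w) \<le> Z"
  shows "adv_cost_horizon A B Q R Qf x0 \<Omega> k T \<le> Z"
  unfolding adv_cost_horizon_def
proof (rule SUP_least)
  fix w assume "w \<in> {..<k} \<rightarrow>\<^sub>E \<Omega>"
  then show "adv_rounds (lqr_cost A B Q R Qf x0 T) \<Omega> T k (T - k) (\<lambda>_. 0) w \<le> Z"
    using assms(1)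
    by (intro adv_rounds_le[where \<pi>=\<pi>] assms(2,3) lqr_cost_cong) (auto simp: PiE_iff)
qed

section \<open>Comparing game values for different numbers of predictions\<close>

context lqr
begin

text \<open>The lower estimate for k' predictions is an offline optimum, in which k' does not occur.
  Hence k and k' are unrelated and the error involves only the k of the controller. The first two
  bounds keep the values finite.\<close>

lemma adv_cost_horizon_bounds:
  assumes Qf: "pos_semidef Qf" and "bounded \<Omega>" "\<Omega> \<noteq> {}"
  obtains C where "C \<ge> 0"
    "\<And>k T. k \<le> T \<Longrightarrow> 0 \<le> adv_cost_horizon A B Q R Qf x0 \<Omega> k T"
    "\<And>k T. k \<le> T \<Longrightarrow> adv_cost_horizon A B Q R Qf x0 \<Omega> k T \<le> ereal (C * (real T + 1))"
    "\<And>k k' T m. \<lbrakk>k \<le> T; k' \<le> T; 1 \<le> m; m \<le> T\<rbrakk> \<Longrightarrow>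
      adv_cost_horizon A B Q R Qf x0 \<Omega> k T \<le> adv_cost_horizon A B Q R Qf x0 \<Omega> k' T
        + ereal (C * (real T * (spectral_norm (matrix_power F k))\<^sup>2 + real k + real m + real T / real m))"
proof -
  obtain W where W: "\<And>x. x \<in> \<Omega> \<Longrightarrow> norm x \<le> W"
    using \<open>bounded \<Omega>\<close> by (auto simp: bounded_iff)
  obtain \<omega> where \<omega>: "\<omega> \<in> \<Omega>" using \<open>\<Omega> \<noteq> {}\<close> by blast
  then have "W \<ge> 0" using W norm_ge_zero order_trans by blast
  define J where "J T = lqr_cost A B Q R Qf x0 T" for T
  define E where "E C k T m = C * (real T * (spectral_norm (matrix_power F k))\<^sup>2 + real k + real m + real T / real m)"
    for C and k T m :: nat
  obtain C where C: "C \<ge> 0" "\<And>w k T. (\<And>s. norm (w s) \<le> W) \<Longrightarrow> J T (mpc_control x0 w k) w \<le> C * (real T + 1)"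
    "\<And>w k T m u. \<lbrakk>\<And>s. norm (w s) \<le> W; 1 \<le> m; m \<le> T\<rbrakk> \<Longrightarrow>
      J T (mpc_control x0 w k) w \<le> J T u w + E C k T m"
    by (rule mpc_near_optimal[OF \<open>W \<ge> 0\<close> Qf, of x0, folded J_def E_def]) (rule that; (assumption | blast))
  \<comment> \<open>The entries of \<open>w\<close> beyond the horizon are junk; replacing them by \<open>0\<close> keeps them bounded.\<close>
  define cut where "cut T w s = (if s < T then w s else 0)" for T and w :: "nat \<Rightarrow> real^'n" and s :: nat
  have cut_bound: "norm (cut T w s) \<le> W" if "\<And>t. t < T \<Longrightarrow> w t \<in> \<Omega>" for T w s
    using W that \<open>W \<ge> 0\<close> by (simp add: cut_def)
  have cut_cost: "J T u w = J T u (cut T w)" for T u w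
    unfolding J_def by (intro lqr_cost_cong) (simp_all add: cut_def)
  have le: "adv_cost_horizon A B Q R Qf x0 \<Omega> k T \<le> Z"
    if "k \<le> T"
      and Z: "\<And>w. (\<And>t. t < T \<Longrightarrow> w t \<in> \<Omega>) \<Longrightarrow> ereal (J T (mpc_control x0 (cut T w) k) (cut T w)) \<le> Z" for k T Z
  proof (rule adv_cost_horizon_le[where \<pi>="\<lambda>w. mpc_control x0 (cut T w) k"])
    show "mpc_control x0 (cut T w) k t = mpc_control x0 (cut T w') k t" if "\<And>s. s < t + k \<Longrightarrow> w s = w' s" for w w' t
      using that by (intro mpc_control_nonanticipative) (simp add: cut_def)
    show "ereal (lqr_cost A B Q R Qf x0 T (mpc_control x0 (cut T w) k) w) \<le> Z" if "\<And>t. t < T \<Longrightarrow> w t \<in> \<Omega>" for w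
      using Z[OF that] cut_cost[of T _ w] by (simp add: J_def)
  qed fact
  show ?thesis
  proof (rule that[OF C(1)])
    fix k T :: nat assume "k \<le> T"
    have "0 \<le> (INF u. ereal (J T u (\<lambda>_. \<omega>)))"
      using Qf by (intro INF_greatest)
        (auto simp: J_def lqr_cost_def pos_semidef_def intro!: add_nonneg_nonneg sum_nonneg Q_psd R_psd)
    also have "\<dots> \<le> adv_cost_horizon A B Q R Qf x0 \<Omega> k T"
      unfolding J_def using \<open>k \<le> T\<close> \<omega> by (intro adv_cost_horizon_ge)
    finally show "0 \<le> adv_cost_horizon A B Q R Qf x0 \<Omega> k T" .
    show "adv_cost_horizon A B Q R Qf x0 \<Omega> k T \<le> ereal (C * (real T + 1))"
      using \<open>k \<le> T\<close> by (intro le) (auto intro!: C(2) cut_bound)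
  next
    fix k k' T m :: nat
    assume "k \<le> T" "k' \<le> T" "1 \<le> m" "m \<le> T"
    show "adv_cost_horizon A B Q R Qf x0 \<Omega> k T \<le> adv_cost_horizon A B Q R Qf x0 \<Omega> k' T
        + ereal (C * (real T * (spectral_norm (matrix_power F k))\<^sup>2 + real k + real m + real T / real m))"
      unfolding E_def[symmetric]
    proof (rule le[OF \<open>k \<le> T\<close>])
      fix w :: "nat \<Rightarrow> real^'n" assume w: "\<And>t. t < T \<Longrightarrow> w t \<in> \<Omega>"
      let ?J = "J T (mpc_control x0 (cut T w) k) (cut T w)"
      have "?J \<le> J T u w + E C k T m" for u
        using C(3)[OF cut_bound[OF w] \<open>1 \<le> m\<close> \<open>m \<le> T\<close>, where u=u] cut_cost[of T u w] by simp
      \<comment> \<open>The finite error is subtracted before the infimum is taken and added back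
        afterwards, so no sum has to be moved through an infimum in \<open>ereal\<close>.\<close>
      then have "ereal (?J - E C k T m) \<le> (INF u. ereal (J T u w))"
        by (intro INF_greatest) (simp add: diff_le_eq)
      also have "\<dots> \<le> adv_cost_horizon A B Q R Qf x0 \<Omega> k' T"
        unfolding J_def using \<open>k' \<le> T\<close> w by (rule adv_cost_horizon_ge)
      finally have "ereal (?J - E C k T m) + ereal (E C k T m)
          \<le> adv_cost_horizon A B Q R Qf x0 \<Omega> k' T + ereal (E C k T m)"
        by (rule add_right_mono)
      then show "ereal ?J \<le> adv_cost_horizon A B Q R Qf x0 \<Omega> k' T + ereal (E C k T m)" by simp
    qed
  qed
qed

lemma adv_cost_diff_bound:
  assumes Qf: "pos_semidef Qf" and \<Omega>: "bounded \<Omega>" "\<Omega> \<noteq> {}"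
    and conv: "\<And>k. k \<ge> 1 \<Longrightarrow> convergent (adv_cost_avg A B Q R Qf x0 \<Omega> k)"
  obtains C l where "C \<ge> 0" "\<And>k. k \<ge> 1 \<Longrightarrow> adv_cost A B Q R Qf x0 \<Omega> k = ereal (l k)"
    "\<And>k k'. \<lbrakk>k \<ge> 1; k' \<ge> 1\<rbrakk> \<Longrightarrow> l k \<le> l k' + C * (spectral_norm (matrix_power F k))\<^sup>2"
proof -
  define h where "h = adv_cost_horizon A B Q R Qf x0 \<Omega>"
  define f where "f k = (spectral_norm (matrix_power F k))\<^sup>2" for k
  obtain C where C: "C \<ge> 0" "\<And>k T. k \<le> T \<Longrightarrow> 0 \<le> h k T" "\<And>k T. k \<le> T \<Longrightarrow> h k T \<le> ereal (C * (real T + 1))"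
    "\<And>k k' T m. \<lbrakk>k \<le> T; k' \<le> T; 1 \<le> m; m \<le> T\<rbrakk> \<Longrightarrow>
      h k T \<le> h k' T + ereal (C * (real T * f k + real k + real m + real T / real m))"
    by (rule adv_cost_horizon_bounds[OF Qf \<Omega>, of x0, folded h_def f_def]) (rule that; (assumption | blast))
  define a where "a k T = real_of_ereal (h k T)" for k T
  have h: "h k T = ereal (a k T)" if "k \<le> T" for k T
    using C(2,3)[OF that] by (cases "h k T") (auto simp: a_def)
  have avg: "adv_cost_avg A B Q R Qf x0 \<Omega> k T = ereal (a k T / real T)" if "k \<ge> 1" "k \<le> T" for k T
    using that h[OF that(2)] by (simp add: adv_cost_avg_def h_def)
  have lim: "adv_cost_avg A B Q R Qf x0 \<Omega> k \<longlonglongrightarrow> adv_cost A B Q R Qf x0 \<Omega> k" if "k \<ge> 1" for k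
    using conv[OF that] by (simp add: convergent_LIMSEQ_iff adv_cost_def)
  define l where "l k = real_of_ereal (adv_cost A B Q R Qf x0 \<Omega> k)" for k
  have l: "adv_cost A B Q R Qf x0 \<Omega> k = ereal (l k)" if "k \<ge> 1" for k
  proof -
    \<comment> \<open>Averages confined to [0, 2 C] from T = k on force a finite limit; T \<ge> k
      \<ge> 1 gives T + 1 \<le> 2 T.\<close>
    have "0 \<le> a k T / real T \<and> a k T / real T \<le> 2 * C" if "k \<le> T" for T
    proof -
      have "a k T \<le> C * (real T + 1)" "0 \<le> a k T" using C(2,3)[OF that] h[OF that] by auto
      moreover have "C * (real T + 1) \<le> C * (2 * real T)"
        using \<open>k \<ge> 1\<close> that C(1) by (intro mult_left_mono) auto
      ultimately show ?thesis using \<open>k \<ge> 1\<close> that by (simp add: divide_le_eq)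
    qed
    then have *: "0 \<le> adv_cost_avg A B Q R Qf x0 \<Omega> k T \<and> adv_cost_avg A B Q R Qf x0 \<Omega> k T \<le> ereal (2 * C)" if "T \<ge> k" for T
      using avg[OF \<open>k \<ge> 1\<close> that] that by simp
    have "0 \<le> adv_cost A B Q R Qf x0 \<Omega> k"
      by (rule LIMSEQ_le_const[OF lim[OF \<open>k \<ge> 1\<close>]]) (use * in blast)
    moreover have "adv_cost A B Q R Qf x0 \<Omega> k \<le> ereal (2 * C)"
      by (rule LIMSEQ_le_const2[OF lim[OF \<open>k \<ge> 1\<close>]]) (use * in blast)
    ultimately show ?thesis by (cases "adv_cost A B Q R Qf x0 \<Omega> k") (auto simp: l_def)
  qed
  have lim_a: "(\<lambda>T. a k T / real T) \<longlonglongrightarrow> l k" if "k \<ge> 1" for k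
  proof -
    have "(\<lambda>T. ereal (a k T / real T)) \<longlonglongrightarrow> ereal (l k)"
      using lim[OF that] unfolding l[OF that]
      by (rule Lim_transform_eventually) (use avg[OF that] in \<open>auto simp: eventually_sequentially\<close>)
    then show ?thesis by simp
  qed
  have "l k \<le> l k' + C * f k" if k: "k \<ge> 1" "k' \<ge> 1" for k k'
  proof -
    \<comment> \<open>The window m stays fixed while T tends to infinity: (k + m) / T vanishes and 1
      / m remains, to be removed by a second limit in m.\<close>
    have "l k \<le> l k' + C * f k + C * (1 / real m)" if "m \<ge> 1" for m :: nat
    proof (rule LIMSEQ_le[OF lim_a[OF k(1)]])
      have "(\<lambda>T. a k' T / real T + C * f k + C * (real k + real m) / real T + C * (1 / real m))
          \<longlonglongrightarrow> l k' + C * f k + 0 + C * (1 / real m)"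
        by (intro tendsto_add lim_a k tendsto_const lim_const_over_n)
      then show "(\<lambda>T. a k' T / real T + C * f k + C * (real k + real m) / real T + C * (1 / real m))
          \<longlonglongrightarrow> l k' + C * f k + C * (1 / real m)" by simp
      have "a k T / real T \<le> a k' T / real T + C * f k + C * (real k + real m) / real T + C * (1 / real m)"
        if "T \<ge> k + k' + m" for T
      proof -
        have "a k T \<le> a k' T + C * (real T * f k + real k + real m + real T / real m)"
          using C(4)[of k T k' m] h[of k T] h[of k' T] that \<open>m \<ge> 1\<close> by simp
        then have "a k T / real T \<le> (a k' T + C * (real T * f k + real k + real m + real T / real m)) / real T"
          by (rule divide_right_mono) simp
        also have "\<dots> = a k' T / real T + C * f k + C * (real k + real m) / real T + C * (1 / real m)"
          using that k by (simp add: field_simps)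
        finally show ?thesis .
      qed
      then show "\<exists>N. \<forall>T\<ge>N. a k T / real T
          \<le> a k' T / real T + C * f k + C * (real k + real m) / real T + C * (1 / real m)" by blast
    qed
    moreover have "(\<lambda>m. l k' + C * f k + C * (1 / real m)) \<longlonglongrightarrow> l k' + C * f k + C * 0"
      by (intro tendsto_intros lim_const_over_n)
    ultimately show ?thesis
      using LIMSEQ_le_const[of "\<lambda>m. l k' + C * f k + C * (1 / real m)" "l k' + C * f k" "l k"] by auto
  qed
  then show ?thesis using that C(1) l unfolding f_def by blast
qed

end

theorem theorem5p1:
  fixes A :: "real^'n^'n" and B :: "real^'d^'n"
    and Q Qf P F :: "real^'n^'n" and R :: "real^'d^'d"
    and x0 :: "real^'n" and \<Omega> :: "(real^'n) set" and lam :: real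
  assumes "pos_semidef Q" and "pos_semidef Qf" and "pos_def R"
    and "stabilizable A B" and "detectable A Q"
    and "pos_semidef P" and "dare A B Q R P"
    and "F = A - B ** lqr_gain A B R P"
    and "lam = (1 + spectral_radius F) / 2"
    and "bounded \<Omega>" and "\<Omega> \<noteq> {}"
    and "\<And>k. k \<ge> 1 \<Longrightarrow> convergent (adv_cost_avg A B Q R Qf x0 \<Omega> k)"
  shows "(\<exists>C>0. \<forall>k\<ge>1.
            \<bar>adv_cost A B Q R Qf x0 \<Omega> k - adv_cost A B Q R Qf x0 \<Omega> (k + 1)\<bar>
              \<le> ereal (C * (spectral_norm (matrix_power F k))\<^sup>2)) \<and>
         (\<exists>C>0. \<forall>k\<ge>1.
            \<bar>(spectral_norm (matrix_power F k))\<^sup>2\<bar> \<le> C * lam ^ (2 * k))"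
proof
  interpret L: lqr A B Q P R by unfold_locales fact+
  have F: "L.F = F" using assms(8) by (simp add: L.F_def L.K_def)
  define f where "f k = (spectral_norm (matrix_power F k))\<^sup>2" for k
  obtain C l where C: "C \<ge> 0" and l: "\<And>k. k \<ge> 1 \<Longrightarrow> adv_cost A B Q R Qf x0 \<Omega> k = ereal (l k)"
    and diff: "\<And>k k'. \<lbrakk>k \<ge> 1; k' \<ge> 1\<rbrakk> \<Longrightarrow> l k \<le> l k' + C * f k"
    by (rule L.adv_cost_diff_bound[OF assms(2,10-12), unfolded F, folded f_def], assumption) (rule that; (assumption | blast))
  have f_Suc: "f (k + 1) \<le> (spectral_norm F)\<^sup>2 * f k" for k
    unfolding f_def power_mult_distrib[symmetric]
    using spectral_norm_mult_le[of F "matrix_power F k"] by (intro power_mono) (simp_all add: spectral_norm_ge_0)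
  show "\<exists>C>0. \<forall>k\<ge>1. \<bar>adv_cost A B Q R Qf x0 \<Omega> k - adv_cost A B Q R Qf x0 \<Omega> (k + 1)\<bar>
      \<le> ereal (C * (spectral_norm (matrix_power F k))\<^sup>2)"
  proof (intro exI conjI allI impI)
    \<comment> \<open>The comparison is used in both directions: C bounds the step from k + 1 to k,
      and C times the square of ||F|| the reverse one through \<open>f_Suc\<close>. The final 1
      makes the constant positive.\<close>
    let ?D = "C * (1 + (spectral_norm F)\<^sup>2) + 1"
    show "?D > 0" using C by (simp add: add_nonneg_pos)
    fix k :: nat assume "k \<ge> 1"
    have "f k \<ge> 0" by (simp add: f_def)
    have "C * f (k + 1) \<le> C * ((spectral_norm F)\<^sup>2 * f k)" by (intro mult_left_mono f_Suc C)
    moreover have "0 \<le> C * f k" "0 \<le> C * ((spectral_norm F)\<^sup>2 * f k)"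
      using C \<open>f k \<ge> 0\<close> by simp_all
    moreover have "?D * f k = C * f k + C * ((spectral_norm F)\<^sup>2 * f k) + f k"
      by (simp add: algebra_simps)
    moreover have "l k \<le> l (k + 1) + C * f k" "l (k + 1) \<le> l k + C * f (k + 1)"
      using \<open>k \<ge> 1\<close> by (intro diff; simp)+
    ultimately have "\<bar>l k - l (k + 1)\<bar> \<le> ?D * f k"
      using \<open>f k \<ge> 0\<close> by linarith
    then show "\<bar>adv_cost A B Q R Qf x0 \<Omega> k - adv_cost A B Q R Qf x0 \<Omega> (k + 1)\<bar>
        \<le> ereal (?D * (spectral_norm (matrix_power F k))\<^sup>2)"
      using l[of k] l[of "k + 1"] \<open>k \<ge> 1\<close> unfolding f_def by simp
  qed
  \<comment> \<open>As the mean of the spectral radius and 1, lam lies strictly above the former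
    because the closed loop is stable.\<close>
  have "spectral_radius F < lam" using L.closed_loop_stable F assms(9) by simp
  then obtain c where c: "\<And>k. spectral_norm (matrix_power F k) \<le> c * lam ^ k"
    using spectral_norm_power_decay by blast
  show "\<exists>C>0. \<forall>k\<ge>1. \<bar>(spectral_norm (matrix_power F k))\<^sup>2\<bar> \<le> C * lam ^ (2 * k)"
  proof (intro exI conjI allI impI)
    show "c\<^sup>2 + 1 > 0" by (simp add: add_nonneg_pos)
    fix k :: nat
    have "(spectral_norm (matrix_power F k))\<^sup>2 \<le> (c * lam ^ k)\<^sup>2"
      by (intro power_mono c spectral_norm_ge_0)
    also have "\<dots> = c\<^sup>2 * lam ^ (2 * k)"
      by (simp add: power_mult_distrib power_mult[symmetric] mult.commute)
    also have "\<dots> \<le> (c\<^sup>2 + 1) * lam ^ (2 * k)"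
      by (simp add: distrib_right)
    finally show "\<bar>(spectral_norm (matrix_power F k))\<^sup>2\<bar> \<le> (c\<^sup>2 + 1) * lam ^ (2 * k)" by simp
  qed
qed

end
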